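(* Let $\mathcal S=(\mathcal M,X)$ be an irreducible concurrent system equipped with a Markov measure $\nu=(\nu_\alpha)_{\alpha\in X}$. Let $Z=(Z_\alpha)_{\alpha\in X}$ be a family of measurable functions $Z_\alpha:\partial\mathcal M_\alpha\to\mathbb R$ that are non-negative or bounded, and assume that $Z$ is shift-invariant. Then there is a constant $z$ such that, for all $\alpha\in X$, $Z_\alpha(\omega)=z$ for $\nu_\alpha$-almost every $\omega\in\partial\mathcal M_\alpha$.
   Context: Trace monoids. Let $\Sigma$ be a finite set and $I\subseteq\Sigma\times\Sigma$ irreflexive and symmetric. The trace monoid $\mathcal M=\mathcal M(\Sigma,I)$ is presented by $\langle\Sigma\mid ab=ba\text{ for }(a,b)\in I\rangle$. Its elements are traces, $\varepsilon$ is the unit, and $x\leqslant y$ means $y=xz$ for some $z\in\mathcal M$. $\mathcal M$ is irreducible if the graph $(\Sigma,(\Sigma\times\Sigma)\setminus I)$ is connected. A clique is a trace $a_1\cdots a_k$ of letters with $(a_i,a_j)\in I$ for $i\neq j$; cliques are identified with subsets of $\Sigma$. For cliques write $c\to d$ if for every letter $b\in d$ there is a letter $a\in c$ with $(a,b)\notin I$. Every trace $x$ has a unique normal form $x=c_1\cdots c_n$ with non-empty cliques $c_i\to c_{i+1}$; put $C_i(x)=c_i$ for $i\leqslant n$ and $C_i(x)=\varepsilon$ for $i>n$. Infinite traces. An infinite trace is a sequence $\omega=(c_i)_{i\geqslant1}$ of non-empty cliques with $c_i\to c_{i+1}$ for all $i$; write $C_i(\omega)=c_i$. The set $\partial\mathcal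 M$ of infinite traces carries its Borel $\sigma$-algebra. For $x\in\mathcal M$, $x\leqslant\omega$ means $x\leqslant C_1(\omega)\cdots C_n(\omega)$ for some $n$, and ${\uparrow}x=\{\omega\in\partial\mathcal M:x\leqslant\omega\}$. For $x\in\mathcal M$ and $\xi\in\partial\mathcal M$, the concatenation $x\xi\in\partial\mathcal M$ is the infinite trace whose $i$-th clique is the eventually constant value, as $n\to\infty$, of $C_i(x\,C_1(\xi)\cdots C_n(\xi))$. If $x\leqslant\omega$ there is a unique $\xi$ with $\omega=x\xi$, denoted $x^{-1}\omega$. Concurrent systems. A concurrent system is a pair $(\mathcal M,X)$, $X$ a finite set of states, with a right monoid action of $\mathcal M$ on $X\sqcup\{\bot\}$, where $\bot\cdot x=\bot$ for all $x$. Put $\mathcal M_\alpha=\{x:\alpha\cdot x\neq\bot\}$, $\mathcal M_{\alpha,\beta}=\{x:\alpha\cdot x=\beta\}$, and $\partial\mathcal M_\alpha=\{\omega\in\partial\mathcal M: x\in\mathcal M_\alpha\text{ for all }x\in\mathcal M\text{ with }x\leqslant\omega\}$. Non-trivial: $\alpha\cdot a\neq\bot$ for some $\alpha\in X$, $a\in\Sigma$. Transitive: $\mathcal M_{\alpha,\beta}\neq\emptyset$ for all $\alpha,\beta\in X$. Irreducible: (1) transitive and non-trivial; (2) $\mathcal M$ is irreducible; (3) for all $\alpha\in X$, $a\in\Sigma$ there is $u\in\mathcal M$ with $\alpha\cdot(ua)\neq\bot$. Markov measures. A Markov measure is a family $\nu=(\nu_\alpha)_{\alpha\in X}$ of probability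 measures on $\partial\mathcal M$ with $\nu_\alpha(\partial\mathcal M_\alpha)=1$, $x\in\mathcal M_\alpha\iff\nu_\alpha({\uparrow}x)>0$, and $\nu_\alpha({\uparrow}(xy))=\nu_\alpha({\uparrow}x)\,\nu_{\alpha\cdot x}({\uparrow}y)$ for all $\alpha\in X$, $x,y\in\mathcal M$ (right-hand side $0$ if $\alpha\cdot x=\bot$). Shift-invariance. $Z$ is shift-invariant if for every $\alpha\in X$ and $\nu_\alpha$-almost every $\omega\in\partial\mathcal M_\alpha$: for all $x\in\mathcal M_\alpha$, if $x\leqslant\omega$ then $Z_\alpha(\omega)=Z_{\alpha\cdot x}(x^{-1}\omega)$. *)

theory Defs
  imports "HOL-Algebra.Divisibility" "HOL-Probability.Probability"
begin

section \<open>Trace monoids\<close>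

text \<open>The least congruence on words that contains \<open>ab = ba\<close> for all \<open>(a, b) \<in> I\<close>.\<close>

inductive commutation_eq :: "('a \<times> 'a) set \<Rightarrow> 'a list \<Rightarrow> 'a list \<Rightarrow> bool"
  for I :: "('a \<times> 'a) set" where
  refl: "commutation_eq I u u"
| sym: "commutation_eq I u v \<Longrightarrow> commutation_eq I v u"
| trans: "commutation_eq I u v \<Longrightarrow> commutation_eq I v w \<Longrightarrow> commutation_eq I u w"
| cong: "commutation_eq I u u' \<Longrightarrow> commutation_eq I v v' \<Longrightarrow> commutation_eq I (u @ v) (u' @ v')"
| commute: "(a, b) \<in> I \<Longrightarrow> commutation_eq I [a, b] [b, a]"

locale trace_monoid =
  fixes \<Sigma> :: "'a set" and I :: "('a \<times> 'a) set"
  assumes finite_alphabet: "finite \<Sigma>"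
    and indep_subset: "I \<subseteq> \<Sigma> \<times> \<Sigma>"
    and indep_irrefl: "irrefl I"
    and indep_sym: "sym I"
begin

definition trace_rel :: "('a list \<times> 'a list) set" where
  "trace_rel = {(u, v). u \<in> lists \<Sigma> \<and> v \<in> lists \<Sigma> \<and> commutation_eq I u v}"

definition trace_of :: "'a list \<Rightarrow> 'a list set" where
  "trace_of w = trace_rel `` {w}"

definition M :: "'a list set monoid" where
  "M = \<lparr>carrier = lists \<Sigma> // trace_rel,
        mult = (\<lambda>x y. \<Union>u\<in>x. \<Union>v\<in>y. trace_of (u @ v)),
        one = trace_of []\<rparr>"

definition irreducible_monoid :: bool where
  "irreducible_monoid \<longleftrightarrow> (\<forall>a\<in>\<Sigma>. \<forall>b\<in>\<Sigma>. (a, b) \<in> ((\<Sigma> \<times> \<Sigma>) - I)\<^sup>*)"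

text \<open>Cliques are represented by subsets of the alphabet; \<open>clique_trace c\<close> is the trace that
  corresponds to the clique \<open>c\<close> (see \<open>clique_trace_eq\<close> below for the independence from the
  chosen enumeration). The empty set stands for the unit.\<close>

definition clique :: "'a set \<Rightarrow> bool" where
  "clique c \<longleftrightarrow> c \<subseteq> \<Sigma> \<and> pairwise (\<lambda>a b. (a, b) \<in> I) c"

definition clique_trace :: "'a set \<Rightarrow> 'a list set" where
  "clique_trace c = trace_of (SOME w. distinct w \<and> set w = c)"

definition clique_prod :: "'a set list \<Rightarrow> 'a list set" where
  "clique_prod cs = foldr (\<lambda>c x. clique_trace c \<otimes>\<^bsub>M\<^esub> x) cs \<one>\<^bsub>M\<^esub>"

definition clique_arrow :: "'a set \<Rightarrow> 'a set \<Rightarrow> bool" where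
  "clique_arrow c d \<longleftrightarrow> (\<forall>b\<in>d. \<exists>a\<in>c. (a, b) \<notin> I)"

definition normal_form :: "'a list set \<Rightarrow> 'a set list \<Rightarrow> bool" where
  "normal_form x cs \<longleftrightarrow>
     (\<forall>c\<in>set cs. clique c \<and> c \<noteq> {}) \<and> successively clique_arrow cs \<and> clique_prod cs = x"

text \<open>Sequences of cliques are indexed from \<open>0\<close>: \<open>trace_clique i x\<close> is \<open>C\<^sub>i\<^sub>+\<^sub>1(x)\<close>, and
  likewise \<open>\<omega> i\<close> is \<open>C\<^sub>i\<^sub>+\<^sub>1(\<omega>)\<close> for an infinite trace \<open>\<omega>\<close>.\<close>

definition trace_clique :: "nat \<Rightarrow> 'a list set \<Rightarrow> 'a set" where
  "trace_clique i x = (let cs = (THE cs. normal_form x cs) in if i < length cs then cs ! i else {})"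


subsection \<open>Infinite traces\<close>

definition boundary :: "(nat \<Rightarrow> 'a set) set" where
  "boundary = {\<omega>. \<forall>i. clique (\<omega> i) \<and> \<omega> i \<noteq> {} \<and> clique_arrow (\<omega> i) (\<omega> (Suc i))}"

text \<open>The Borel sets for the topology induced by the product of the discrete topologies.\<close>

definition boundary_topology :: "(nat \<Rightarrow> 'a set) topology" where
  "boundary_topology =
     subtopology (product_topology (\<lambda>_. discrete_topology UNIV) UNIV) boundary"

definition boundary_space :: "(nat \<Rightarrow> 'a set) measure" where
  "boundary_space = sigma boundary {U. openin boundary_topology U}"

definition prefix :: "(nat \<Rightarrow> 'a set) \<Rightarrow> nat \<Rightarrow> 'a list set" where
  "prefix \<omega> n = clique_prod (map \<omega> [0..<n])"

definition below :: "'a list set \<Rightarrow> (nat \<Rightarrow> 'a set) \<Rightarrow> bool" where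
  "below x \<omega> \<longleftrightarrow> (\<exists>n. x divides\<^bsub>M\<^esub> prefix \<omega> n)"

definition up :: "'a list set \<Rightarrow> (nat \<Rightarrow> 'a set) set" where
  "up x = {\<omega> \<in> boundary. below x \<omega>}"

definition concat_inf :: "'a list set \<Rightarrow> (nat \<Rightarrow> 'a set) \<Rightarrow> nat \<Rightarrow> 'a set" where
  "concat_inf x \<xi> =
     (\<lambda>i. THE c. \<forall>\<^sub>F n in sequentially. trace_clique i (x \<otimes>\<^bsub>M\<^esub> prefix \<xi> n) = c)"

definition residual :: "'a list set \<Rightarrow> (nat \<Rightarrow> 'a set) \<Rightarrow> nat \<Rightarrow> 'a set" where
  "residual x \<omega> = (THE \<xi>. \<xi> \<in> boundary \<and> \<omega> = concat_inf x \<xi>)"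


subsection \<open>Well-definedness\<close>

lemma equiv_trace_rel: "equiv (lists \<Sigma>) trace_rel"
  by (rule equivI) (auto simp: trace_rel_def refl_on_def sym_def trans_def
      intro: commutation_eq.refl commutation_eq.sym commutation_eq.trans)

lemma carrier_M: "carrier M = trace_of ` lists \<Sigma>"
  by (auto simp: M_def trace_of_def quotient_def)

lemma one_M: "\<one>\<^bsub>M\<^esub> = trace_of []"
  by (simp add: M_def)

lemma trace_eq_iff:
  assumes "u \<in> lists \<Sigma>" "v \<in> lists \<Sigma>"
  shows "trace_of u = trace_of v \<longleftrightarrow> commutation_eq I u v"
  unfolding trace_of_def using eq_equiv_class_iff[OF equiv_trace_rel assms] assms
  by (simp add: trace_rel_def)

lemma mult_trace:
  assumes "u \<in> lists \<Sigma>" "v \<in> lists \<Sigma>"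
  shows "trace_of u \<otimes>\<^bsub>M\<^esub> trace_of v = trace_of (u @ v)"
proof -
  have "(\<lambda>u v. trace_of (u @ v)) respects2 trace_rel"
    by (rule congruent2I'[of trace_rel trace_rel])
       (auto simp: trace_rel_def trace_eq_iff intro: commutation_eq.cong)
  from UN_equiv_class2[OF equiv_trace_rel equiv_trace_rel this assms]
  show ?thesis by (simp add: M_def trace_of_def)
qed

lemma monoid_M: "monoid M"
  by (rule monoidI)
     (auto simp: carrier_M one_M mult_trace in_lists_conv_set[symmetric] simp del: in_lists_conv_set)

lemma commutation_eq_Cons_append:
  assumes "\<And>b. b \<in> set u \<Longrightarrow> (a, b) \<in> I"
  shows "commutation_eq I (a # u) (u @ [a])"
  using assms
proof (induction u)
  case Nil
  then show ?case by (simp add: commutation_eq.refl)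
next
  case (Cons b u)
  have "commutation_eq I ([a, b] @ u) ([b, a] @ u)"
    using Cons.prems by (intro commutation_eq.cong commutation_eq.commute commutation_eq.refl) auto
  moreover have "commutation_eq I ([b] @ (a # u)) ([b] @ (u @ [a]))"
    using Cons by (intro commutation_eq.cong commutation_eq.refl) auto
  ultimately show ?case by (auto intro: commutation_eq.trans)
qed

lemma commutation_eq_enumerations:
  assumes "clique c" "distinct u" "set u = c" "distinct v" "set v = c"
  shows "commutation_eq I u v"
  using assms
proof (induction u arbitrary: c v)
  case Nil
  then show ?case by (auto intro: commutation_eq.refl)
next
  case (Cons a u)
  then obtain v1 v2 where v: "v = v1 @ a # v2"
    by (metis list.set_intros(1) split_list)
  have "clique (set u)"
    using Cons.prems by (auto simp: clique_def pairwise_def)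
  moreover have "set (v1 @ v2) = set u" "distinct (v1 @ v2)"
    using Cons.prems v by auto
  ultimately have "commutation_eq I u (v1 @ v2)"
    using Cons.IH[of "set u" "v1 @ v2"] Cons.prems by simp
  then have 1: "commutation_eq I ([a] @ u) ([a] @ (v1 @ v2))"
    by (intro commutation_eq.cong commutation_eq.refl)
  have "commutation_eq I (a # v1) (v1 @ [a])"
  proof (rule commutation_eq_Cons_append)
    fix b assume "b \<in> set v1"
    then have "a \<in> c" "b \<in> c" "a \<noteq> b"
      using Cons.prems v by auto
    then show "(a, b) \<in> I"
      using Cons.prems(1) by (simp add: clique_def pairwise_def)
  qed
  then have "commutation_eq I ((a # v1) @ v2) ((v1 @ [a]) @ v2)"
    by (intro commutation_eq.cong commutation_eq.refl)
  with 1 show ?case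
    by (auto simp: v intro: commutation_eq.trans)
qed

lemma clique_trace_eq:
  assumes "clique c" "distinct w" "set w = c"
  shows "clique_trace c = trace_of w"
proof -
  let ?v = "SOME w. distinct w \<and> set w = c"
  have "distinct ?v \<and> set ?v = c"
    by (rule someI[of _ w]) (use assms in auto)
  then show ?thesis
    using assms commutation_eq_enumerations[of c ?v w] unfolding clique_trace_def
    by (subst trace_eq_iff) (auto simp: clique_def)
qed

end


section \<open>Concurrent systems\<close>

text \<open>The set \<open>X \<squnion> {\<bottom>}\<close> is encoded with the option type, \<open>None\<close> playing the role of \<open>\<bottom>\<close>.\<close>

locale concurrent_system = trace_monoid \<Sigma> I
  for \<Sigma> :: "'a set" and I :: "('a \<times> 'a) set" +
  fixes X :: "'s set" and act :: "'s option \<Rightarrow> 'a list set \<Rightarrow> 's option"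
  assumes finite_states: "finite X"
    and act_closed: "\<And>p x. p \<in> insert None (Some ` X) \<Longrightarrow> x \<in> carrier M \<Longrightarrow>
                       act p x \<in> insert None (Some ` X)"
    and act_one: "\<And>p. p \<in> insert None (Some ` X) \<Longrightarrow> act p \<one>\<^bsub>M\<^esub> = p"
    and act_mult: "\<And>p x y. p \<in> insert None (Some ` X) \<Longrightarrow> x \<in> carrier M \<Longrightarrow> y \<in> carrier M \<Longrightarrow>
                     act p (x \<otimes>\<^bsub>M\<^esub> y) = act (act p x) y"
    and act_bot: "\<And>x. x \<in> carrier M \<Longrightarrow> act None x = None"
begin

definition traces_from :: "'s \<Rightarrow> 'a list set set" where
  "traces_from \<alpha> = {x \<in> carrier M. act (Some \<alpha>) x \<noteq> None}"

definition traces_between :: "'s \<Rightarrow> 's \<Rightarrow> 'a list set set" where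
  "traces_between \<alpha> \<beta> = {x \<in> carrier M. act (Some \<alpha>) x = Some \<beta>}"

definition boundary_from :: "'s \<Rightarrow> (nat \<Rightarrow> 'a set) set" where
  "boundary_from \<alpha> = {\<omega> \<in> boundary. \<forall>x\<in>carrier M. below x \<omega> \<longrightarrow> x \<in> traces_from \<alpha>}"

definition nontrivial :: bool where
  "nontrivial \<longleftrightarrow> (\<exists>\<alpha>\<in>X. \<exists>a\<in>\<Sigma>. act (Some \<alpha>) (trace_of [a]) \<noteq> None)"

definition transitive :: bool where
  "transitive \<longleftrightarrow> (\<forall>\<alpha>\<in>X. \<forall>\<beta>\<in>X. traces_between \<alpha> \<beta> \<noteq> {})"

definition irreducible_system :: bool where
  "irreducible_system \<longleftrightarrow>
     transitive \<and> nontrivial \<and> irreducible_monoid \<and>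
     (\<forall>\<alpha>\<in>X. \<forall>a\<in>\<Sigma>. \<exists>u\<in>carrier M. act (Some \<alpha>) (u \<otimes>\<^bsub>M\<^esub> trace_of [a]) \<noteq> None)"

definition markov_measure :: "('s \<Rightarrow> (nat \<Rightarrow> 'a set) measure) \<Rightarrow> bool" where
  "markov_measure \<nu> \<longleftrightarrow>
     (\<forall>\<alpha>\<in>X. prob_space (\<nu> \<alpha>) \<and> sets (\<nu> \<alpha>) = sets boundary_space \<and>
        measure (\<nu> \<alpha>) (boundary_from \<alpha>) = 1 \<and>
        (\<forall>x\<in>carrier M. x \<in> traces_from \<alpha> \<longleftrightarrow> measure (\<nu> \<alpha>) (up x) > 0) \<and>
        (\<forall>x\<in>carrier M. \<forall>y\<in>carrier M.
           measure (\<nu> \<alpha>) (up (x \<otimes>\<^bsub>M\<^esub> y)) =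
             (case act (Some \<alpha>) x of
                None \<Rightarrow> 0
              | Some \<beta> \<Rightarrow> measure (\<nu> \<alpha>) (up x) * measure (\<nu> \<beta>) (up y))))"

definition shift_invariant ::
    "('s \<Rightarrow> (nat \<Rightarrow> 'a set) measure) \<Rightarrow> ('s \<Rightarrow> (nat \<Rightarrow> 'a set) \<Rightarrow> real) \<Rightarrow> bool" where
  "shift_invariant \<nu> Z \<longleftrightarrow>
     (\<forall>\<alpha>\<in>X. AE \<omega> in \<nu> \<alpha>. \<omega> \<in> boundary_from \<alpha> \<longrightarrow>
        (\<forall>x\<in>traces_from \<alpha>. below x \<omega> \<longrightarrow>
           Z \<alpha> \<omega> = Z (the (act (Some \<alpha>) x)) (residual x \<omega>)))"

end

end

theory Submission
  imports Defs
begin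

text \<open>Replace \<open>Z\<close> by a bounded injective function of it and let \<open>h \<alpha>\<close> be the mean of \<open>Z \<alpha>\<close> under \<open>\<nu> \<alpha>\<close>. By the Markov
property, conditionally on \<open>\<up>x\<close> the residual \<open>x\<^sup>-\<^sup>1\<omega>\<close> has law \<open>\<nu> (\<alpha> \<cdot> x)\<close> (\<open>distr_residual\<close>), so
shift-invariance says that the mean of \<open>Z \<alpha>\<close> over \<open>\<up>x\<close> is \<open>h (\<alpha> \<cdot> x)\<close>. If \<open>h\<close> is constant, then
\<open>Z \<alpha>\<close> and that constant have the same integral over every \<open>\<up>x\<close>; these sets generate the Borel sets
and, because traces with a common multiple have a least one, are stable under intersection up to the
empty set (\<open>measure_eqI_up\<close>). Hence \<open>Z \<alpha>\<close> is almost surely that constant.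

That \<open>h\<close> is constant is a maximum principle. Call a trace a first passage of the letter \<open>a\<close> if it is
minimal among the traces containing \<open>a\<close>. The sets \<open>\<up>v\<close>, \<open>v\<close> a first passage of \<open>a\<close>, partition the
infinite traces in which \<open>a\<close> occurs. If \<open>a\<close> occurs almost surely, \<open>h \<alpha>\<close> is thus a weighted mean of
the values \<open>h (\<alpha> \<cdot> v)\<close>, and where \<open>h\<close> is maximal all of these are maximal too. An enabled letter is
its own first passage, so maximality spreads along letters, and by transitivity to all states.

It remains to see that every letter occurs almost surely, infinitely often in fact (\<open>AE_recurs\<close>).
Some letter occurs infinitely often. If another one does not, then, the dependence graph being
connected, there are dependent letters \<open>c\<close>, \<open>d\<close> such that \<open>c\<close> occurs infinitely often and \<open>d\<close> only
finitely often, so some residual of \<open>\<omega>\<close> has infinitely many \<open>c\<close> and no \<open>d\<close>. The latter event is null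
(\<open>recurs_avoids_null\<close>), again by the maximum principle: at a state where its probability is maximal
and positive, no enabled first passage of \<open>c\<close> contains \<open>d\<close>, and each of them leads to a state of the
same kind. Peeling off first passages of \<open>c\<close>, no enabled trace has a \<open>d\<close> before a \<open>c\<close>; but
irreducibility of the system makes some trace of this form enabled.

The combinatorial input is that the first \<open>n\<close> cliques of a normal form multiply to the greatest divisor
that is a product of \<open>n\<close> cliques (\<open>clique_prod_le_take\<close>). Therefore normal forms are unique, an
infinite trace is determined by the finite traces below it, and every increasing sequence of traces of
unbounded length has a supremum among the infinite traces. Concatenation and residual are such suprema,
which yields the property of residuals on which the probabilistic part rests: \<open>y \<le> x\<^sup>-\<^sup>1\<omega>\<close> iff \<open>xy \<le> \<omega>\<close>
(\<open>below_residual\<close>).\<close>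

section \<open>Words up to commutation\<close>

text \<open>Whether \<open>a\<close> can be moved to the front of a word by commutations. Minimal letters and the removal
of a first occurrence are both invariant under commutation; together they allow letters to be cancelled.\<close>

fun minimal_letter :: "('a \<times> 'a) set \<Rightarrow> 'a \<Rightarrow> 'a list \<Rightarrow> bool" where
  "minimal_letter I a [] \<longleftrightarrow> False"
| "minimal_letter I a (b # u) \<longleftrightarrow> a = b \<or> (a, b) \<in> I \<and> minimal_letter I a u"

lemma minimal_letter_append:
  "minimal_letter I a (u @ v) \<longleftrightarrow>
     minimal_letter I a u \<or> (\<forall>b\<in>set u. (a, b) \<in> I) \<and> minimal_letter I a v"
  by (induction u) auto

lemma commutation_eq_count_list:
  "commutation_eq I u v \<Longrightarrow> count_list u a = count_list v a"
  by (induction rule: commutation_eq.induct) auto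

lemma commutation_eq_set:
  "commutation_eq I u v \<Longrightarrow> set u = set v"
  by (induction rule: commutation_eq.induct) auto

lemma commutation_eq_length:
  "commutation_eq I u v \<Longrightarrow> length u = length v"
  by (induction rule: commutation_eq.induct) auto

lemma commutation_eq_minimal_letter:
  assumes "commutation_eq I u v" "sym I" "irrefl I"
  shows "minimal_letter I a u = minimal_letter I a v"
  using assms
  by (induction rule: commutation_eq.induct)
     (auto simp: minimal_letter_append commutation_eq_set dest: symD irreflD)

lemma commutation_eq_remove1:
  assumes "commutation_eq I u v"
  shows "commutation_eq I (remove1 a u) (remove1 a v)"
  using assms
proof (induction rule: commutation_eq.induct)
  case (cong u u' v v')
  then show ?case
    using commutation_eq_set[OF cong.hyps(1)]
    by (auto simp: remove1_append intro: commutation_eq.cong)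
qed (auto intro: commutation_eq.intros)

lemma minimal_letter_commutation_eq:
  assumes "minimal_letter I a u"
  shows "commutation_eq I u (a # remove1 a u)"
  using assms
proof (induction u)
  case (Cons b u)
  show ?case
  proof (cases "a = b")
    case False
    then have "(a, b) \<in> I" "minimal_letter I a u"
      using Cons.prems by auto
    have "commutation_eq I ([b] @ u) ([b] @ (a # remove1 a u))"
      using \<open>minimal_letter I a u\<close> by (intro commutation_eq.cong commutation_eq.refl Cons.IH)
    moreover have "commutation_eq I ([a, b] @ remove1 a u) ([b, a] @ remove1 a u)"
      using \<open>(a, b) \<in> I\<close> by (intro commutation_eq.cong commutation_eq.refl commutation_eq.commute)
    ultimately show ?thesis
      using False by (auto intro: commutation_eq.trans commutation_eq.sym)
  qed (auto intro: commutation_eq.refl)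
qed simp

fun occurs_before :: "'a \<Rightarrow> 'a \<Rightarrow> 'a list \<Rightarrow> bool" where
  "occurs_before d c [] \<longleftrightarrow> False"
| "occurs_before d c (a # u) \<longleftrightarrow> a = d \<and> c \<in> set u \<or> occurs_before d c u"

lemma occurs_before_append:
  "occurs_before d c (u @ v) \<longleftrightarrow> occurs_before d c u \<or> occurs_before d c v \<or> d \<in> set u \<and> c \<in> set v"
  by (induction u) auto

lemma occurs_before_set: "occurs_before d c u \<Longrightarrow> d \<in> set u \<and> c \<in> set u"
  by (induction u) auto

text \<open>The relative order of two dependent letters is an invariant of the trace.\<close>

lemma commutation_eq_occurs_before:
  assumes "commutation_eq I u v" "(c, d) \<notin> I" "sym I"
  shows "occurs_before d c u \<longleftrightarrow> occurs_before d c v"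
  using assms
  by (induction rule: commutation_eq.induct)
     (auto simp: occurs_before_append commutation_eq_set dest: symD)

section \<open>Divisibility of traces\<close>

context trace_monoid
begin

declare in_lists_conv_set [simp del]

abbreviation trace_mult :: "'a list set \<Rightarrow> 'a list set \<Rightarrow> 'a list set" (infixl "\<diamondop>" 70) where
  "x \<diamondop> y \<equiv> x \<otimes>\<^bsub>M\<^esub> y"

abbreviation trace_le :: "'a list set \<Rightarrow> 'a list set \<Rightarrow> bool" (infix "\<preceq>" 50) where
  "x \<preceq> y \<equiv> x divides\<^bsub>M\<^esub> y"

abbreviation letter :: "'a \<Rightarrow> 'a list set" where
  "letter a \<equiv> trace_of [a]"

abbreviation empty_trace :: "'a list set" ("\<epsilon>") where
  "\<epsilon> \<equiv> \<one>\<^bsub>M\<^esub>"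

text \<open>Counted in an arbitrary representative, as commutation preserves the number of occurrences.\<close>

definition occurrences :: "'a \<Rightarrow> 'a list set \<Rightarrow> nat" where
  "occurrences a x = count_list (SOME u. u \<in> x) a"

definition trace_length :: "'a list set \<Rightarrow> nat" where
  "trace_length x = (\<Sum>a\<in>\<Sigma>. occurrences a x)"

definition independent_of :: "'a \<Rightarrow> 'a list set \<Rightarrow> bool" where
  "independent_of a x \<longleftrightarrow> (\<forall>b\<in>\<Sigma>. 0 < occurrences b x \<longrightarrow> (a, b) \<in> I)"

lemma trace_of_carrier [simp, intro]: "u \<in> lists \<Sigma> \<Longrightarrow> trace_of u \<in> carrier M"
  by (auto simp: carrier_M)

lemma traceE:
  assumes "x \<in> carrier M"
  obtains u where "u \<in> lists \<Sigma>" "x = trace_of u"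
  using assms by (auto simp: carrier_M)

lemma letter_carrier [simp, intro]: "a \<in> \<Sigma> \<Longrightarrow> letter a \<in> carrier M"
  by auto

lemmas mult_carrier [simp, intro] = monoid.m_closed[OF monoid_M]
lemmas one_carrier [simp, intro] = monoid.one_closed[OF monoid_M]
lemmas mult_assoc = monoid.m_assoc[OF monoid_M]
lemmas one_mult [simp] = monoid.l_one[OF monoid_M]
lemmas mult_one [simp] = monoid.r_one[OF monoid_M]

lemma occurrences_trace_of:
  assumes "u \<in> lists \<Sigma>"
  shows "occurrences a (trace_of u) = count_list u a"
proof -
  have "u \<in> trace_of u"
    using assms by (auto simp: trace_of_def trace_rel_def intro: commutation_eq.refl)
  then have "(SOME v. v \<in> trace_of u) \<in> trace_of u"
    by (rule someI)
  then have "commutation_eq I u (SOME v. v \<in> trace_of u)"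
    unfolding trace_of_def trace_rel_def by blast
  then show ?thesis
    unfolding occurrences_def by (simp add: commutation_eq_count_list)
qed

lemma occurrences_one [simp]: "occurrences a \<epsilon> = 0"
  by (simp add: one_M occurrences_trace_of)

lemma occurrences_letter [simp]: "b \<in> \<Sigma> \<Longrightarrow> occurrences a (letter b) = (if a = b then 1 else 0)"
  by (simp add: occurrences_trace_of)

lemma occurrences_mult [simp]:
  assumes "x \<in> carrier M" "y \<in> carrier M"
  shows "occurrences a (x \<diamondop> y) = occurrences a x + occurrences a y"
  using assms by (elim traceE) (simp add: mult_trace occurrences_trace_of)

lemma occurrences_outside: "x \<in> carrier M \<Longrightarrow> a \<notin> \<Sigma> \<Longrightarrow> occurrences a x = 0"
  by (elim traceE) (auto simp only: occurrences_trace_of count_list_0_iff in_lists_conv_set)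

lemma trace_length_one [simp]: "trace_length \<epsilon> = 0"
  by (simp add: trace_length_def)

lemma trace_length_mult [simp]:
  "x \<in> carrier M \<Longrightarrow> y \<in> carrier M \<Longrightarrow> trace_length (x \<diamondop> y) = trace_length x + trace_length y"
  by (simp add: trace_length_def sum.distrib)

lemma trace_length_letter [simp]: "a \<in> \<Sigma> \<Longrightarrow> trace_length (letter a) = 1"
  by (simp add: trace_length_def finite_alphabet if_distrib)

lemma trace_induct [consumes 1, case_names one letter]:
  assumes "x \<in> carrier M" "P \<epsilon>"
    "\<And>a x. a \<in> \<Sigma> \<Longrightarrow> x \<in> carrier M \<Longrightarrow> P x \<Longrightarrow> P (letter a \<diamondop> x)"
  shows "P x"
proof -
  have "P (trace_of u)" if "u \<in> lists \<Sigma>" for u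
    using that
  proof (induction u)
    case Nil
    show ?case using assms(2) by (simp add: one_M)
  next
    case (Cons a u)
    then show ?case
      using assms(3)[of a "trace_of u"] mult_trace[of "[a]" u] by auto
  qed
  then show ?thesis
    using assms(1) by (auto simp: carrier_M)
qed

lemma trace_length_0: "x \<in> carrier M \<Longrightarrow> trace_length x = 0 \<Longrightarrow> x = \<epsilon>"
  by (induction rule: trace_induct) auto

lemma independent_of_one [simp]: "independent_of a \<epsilon>"
  by (simp add: independent_of_def)

lemma independent_of_mult [simp]:
  "x \<in> carrier M \<Longrightarrow> y \<in> carrier M \<Longrightarrow> independent_of a (x \<diamondop> y) \<longleftrightarrow> independent_of a x \<and> independent_of a y"
  by (auto simp: independent_of_def)

lemma independent_of_letter [simp]: "b \<in> \<Sigma> \<Longrightarrow> independent_of a (letter b) \<longleftrightarrow> (a, b) \<in> I"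
  by (auto simp: independent_of_def)

lemma independent_commute:
  assumes "a \<in> \<Sigma>" "x \<in> carrier M" "independent_of a x"
  shows "letter a \<diamondop> x = x \<diamondop> letter a"
  using assms(2,3)
proof (induction rule: trace_induct)
  case (letter b x)
  have "letter a \<diamondop> letter b = letter b \<diamondop> letter a"
    using letter assms(1)
    by (auto simp: mult_trace trace_eq_iff intro: commutation_eq.commute)
  then show ?case
    using letter assms(1) by (metis independent_of_mult letter_carrier mult_assoc)
qed (use assms in auto)

lemma letter_le_trace_of:
  assumes "a \<in> \<Sigma>" "u \<in> lists \<Sigma>"
  shows "letter a \<preceq> trace_of u \<longleftrightarrow> minimal_letter I a u"
proof
  assume "letter a \<preceq> trace_of u"
  then obtain v where "v \<in> lists \<Sigma>" "trace_of u = letter a \<diamondop> trace_of v"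
    by (auto simp: factor_def carrier_M)
  then have "commutation_eq I u (a # v)"
    using assms by (simp add: mult_trace trace_eq_iff)
  then show "minimal_letter I a u"
    using commutation_eq_minimal_letter[OF _ indep_sym indep_irrefl] by fastforce
next
  assume "minimal_letter I a u"
  then have "commutation_eq I u (a # remove1 a u)"
    by (rule minimal_letter_commutation_eq)
  moreover have "remove1 a u \<in> lists \<Sigma>"
    using assms by (auto dest: notin_set_remove1 set_remove1_subset[THEN subsetD])
  ultimately have "trace_of u = letter a \<diamondop> trace_of (remove1 a u)"
    using assms by (simp add: mult_trace trace_eq_iff)
  then show "letter a \<preceq> trace_of u"
    using \<open>remove1 a u \<in> lists \<Sigma>\<close> by (auto simp: factor_def)
qed

text \<open>A minimal letter of a product is minimal in the first factor or commutes past it. All later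
combinatorics rests on this fact and on left cancellation.\<close>

lemma letter_le_mult:
  assumes "a \<in> \<Sigma>" "x \<in> carrier M" "y \<in> carrier M"
  shows "letter a \<preceq> x \<diamondop> y \<longleftrightarrow> letter a \<preceq> x \<or> independent_of a x \<and> letter a \<preceq> y"
proof -
  obtain u v where uv: "u \<in> lists \<Sigma>" "v \<in> lists \<Sigma>" "x = trace_of u" "y = trace_of v"
    using assms by (auto simp: carrier_M)
  have "independent_of a x \<longleftrightarrow> (\<forall>b\<in>set u. (a, b) \<in> I)"
    using uv by (auto simp: independent_of_def occurrences_trace_of count_list_0_iff neq0_conv[symmetric]
        simp del: neq0_conv)
  moreover have "u @ v \<in> lists \<Sigma>"
    using uv by auto
  ultimately show ?thesis
    using uv assms(1) by (simp only: mult_trace letter_le_trace_of minimal_letter_append)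
qed

lemma letter_le_letter [simp]: "a \<in> \<Sigma> \<Longrightarrow> b \<in> \<Sigma> \<Longrightarrow> letter a \<preceq> letter b \<longleftrightarrow> a = b"
  by (simp add: letter_le_trace_of)

lemma letter_le_one [simp]: "a \<in> \<Sigma> \<Longrightarrow> \<not> letter a \<preceq> \<epsilon>"
  by (simp add: letter_le_trace_of one_M)

lemma mult_left_cancel:
  assumes "x \<in> carrier M" "y \<in> carrier M" "z \<in> carrier M" "z \<diamondop> x = z \<diamondop> y"
  shows "x = y"
proof -
  have letter_cancel: "x = y" if that: "a \<in> \<Sigma>" "letter a \<diamondop> x = letter a \<diamondop> y"
    and x: "x \<in> carrier M" and y: "y \<in> carrier M" for a x y
  proof -
    obtain u v where uv: "u \<in> lists \<Sigma>" "x = trace_of u" "v \<in> lists \<Sigma>" "y = trace_of v"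
      using traceE[OF x] traceE[OF y] by metis
    then have "commutation_eq I (a # u) (a # v)"
      using that by (simp add: mult_trace trace_eq_iff)
    from commutation_eq_remove1[OF this, of a] show ?thesis
      using uv by (simp add: trace_eq_iff)
  qed
  show ?thesis
    using assms(3,4)
  proof (induction rule: trace_induct)
    case (letter a z)
    then show ?case
      using assms(1,2) letter_cancel[of a "z \<diamondop> x" "z \<diamondop> y"] by (simp add: mult_assoc)
  qed (use assms in auto)
qed

lemma trace_le_refl [simp]: "x \<in> carrier M \<Longrightarrow> x \<preceq> x"
  using monoid.divides_refl[OF monoid_M] .

lemma trace_le_trans [trans]:
  "x \<preceq> y \<Longrightarrow> y \<preceq> z \<Longrightarrow> x \<in> carrier M \<Longrightarrow> x \<preceq> z"
  using monoid.divides_trans[OF monoid_M] .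

lemma trace_le_mult [simp, intro]: "x \<in> carrier M \<Longrightarrow> y \<in> carrier M \<Longrightarrow> x \<preceq> x \<diamondop> y"
  by (auto simp: factor_def)

lemma one_trace_le [simp]: "x \<in> carrier M \<Longrightarrow> \<epsilon> \<preceq> x"
  by (metis one_carrier one_mult trace_le_mult)

lemma trace_leE:
  assumes "x \<preceq> y"
  obtains z where "z \<in> carrier M" "y = x \<diamondop> z"
  using assms by (auto simp: factor_def)

lemma letter_mult_leE:
  assumes "letter a \<diamondop> x \<preceq> w" "a \<in> \<Sigma>" "x \<in> carrier M"
  obtains w' where "w' \<in> carrier M" "w = letter a \<diamondop> w'" "x \<preceq> w'"
proof -
  obtain t where "t \<in> carrier M" "w = letter a \<diamondop> x \<diamondop> t"
    using assms(1) by (auto elim: trace_leE)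
  with that[of "x \<diamondop> t"] assms show thesis
    by (simp add: mult_assoc)
qed

lemma mult_le_mult_iff [simp]:
  "x \<in> carrier M \<Longrightarrow> y \<in> carrier M \<Longrightarrow> z \<in> carrier M \<Longrightarrow> z \<diamondop> x \<preceq> z \<diamondop> y \<longleftrightarrow> x \<preceq> y"
  by (auto simp: factor_def mult_assoc dest!: mult_left_cancel[rotated 3])

lemma occurrences_mono: "x \<preceq> y \<Longrightarrow> x \<in> carrier M \<Longrightarrow> occurrences a x \<le> occurrences a y"
  by (auto elim!: trace_leE)

lemma trace_length_mono: "x \<preceq> y \<Longrightarrow> x \<in> carrier M \<Longrightarrow> trace_length x \<le> trace_length y"
  by (auto elim!: trace_leE)

lemma trace_le_same_length:
  "x \<preceq> y \<Longrightarrow> x \<in> carrier M \<Longrightarrow> trace_length y \<le> trace_length x \<Longrightarrow> x = y"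
  by (metis add_le_same_cancel1 le_zero_eq mult_one trace_leE trace_length_0 trace_length_mult)

lemma trace_le_antisym: "x \<preceq> y \<Longrightarrow> y \<preceq> x \<Longrightarrow> x \<in> carrier M \<Longrightarrow> y \<in> carrier M \<Longrightarrow> x = y"
  by (simp add: trace_le_same_length trace_length_mono)

lemma minimal_letter_exists:
  assumes "x \<in> carrier M" "x \<noteq> \<epsilon>"
  shows "\<exists>a\<in>\<Sigma>. letter a \<preceq> x"
  using assms by (induction rule: trace_induct) auto

text \<open>Write \<open>letter a \<diamondop> w = y \<diamondop> t\<close>. As \<open>a\<close> is not minimal in \<open>y\<close>, it is minimal in \<open>t\<close> and commutes
past \<open>y\<close>, so it can be cancelled on both sides.\<close>

lemma not_letter_le_commutes:
  assumes "a \<in> \<Sigma>" "y \<in> carrier M" "w \<in> carrier M" "y \<preceq> letter a \<diamondop> w" "\<not> letter a \<preceq> y"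
  shows "independent_of a y" "y \<preceq> w"
proof -
  obtain t where t: "t \<in> carrier M" "letter a \<diamondop> w = y \<diamondop> t"
    using assms(4) by (auto elim: trace_leE)
  have "letter a \<preceq> y \<diamondop> t"
    using assms t by (metis letter_carrier trace_le_mult)
  then have *: "independent_of a y" "letter a \<preceq> t"
    using assms t letter_le_mult by auto
  then show "independent_of a y" by simp
  obtain s where s: "s \<in> carrier M" "t = letter a \<diamondop> s"
    using *(2) by (auto elim: trace_leE)
  have "letter a \<diamondop> w = letter a \<diamondop> (y \<diamondop> s)"
    using t(2) s assms independent_commute[OF assms(1,2) *(1)] by (metis letter_carrier mult_assoc)
  then have "w = y \<diamondop> s"
    using assms s by (auto dest: mult_left_cancel[rotated 3])
  then show "y \<preceq> w"
    using assms s by simp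
qed

lemma independent_le_letter_mult:
  assumes "a \<in> \<Sigma>" "y \<in> carrier M" "w \<in> carrier M" "independent_of a y"
  shows "y \<preceq> letter a \<diamondop> w \<longleftrightarrow> y \<preceq> w"
proof
  assume "y \<preceq> letter a \<diamondop> w"
  moreover have "\<not> letter a \<preceq> y"
  proof
    assume "letter a \<preceq> y"
    then have "0 < occurrences a y"
      using occurrences_mono[of "letter a" y a] assms by simp
    then show False
      using assms indep_irrefl by (auto simp: independent_of_def irrefl_def)
  qed
  ultimately show "y \<preceq> w"
    using assms not_letter_le_commutes by blast
next
  assume "y \<preceq> w"
  then obtain t where t: "t \<in> carrier M" "w = y \<diamondop> t"
    by (auto elim: trace_leE)
  then have "letter a \<diamondop> w = y \<diamondop> (letter a \<diamondop> t)"
    using assms independent_commute[OF assms(1,2,4)] by (metis letter_carrier mult_assoc)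
  then show "y \<preceq> letter a \<diamondop> w"
    using assms t by simp
qed

text \<open>Induction on \<open>x\<close>: a first letter of \<open>x\<close> is either also minimal in \<open>y\<close>, and split off from both, or
commutes past \<open>y\<close>. A common multiple has to exist, since two distinct dependent letters have none.\<close>

lemma lcm_exists:
  assumes "x \<in> carrier M" "y \<in> carrier M" "w \<in> carrier M" "x \<preceq> w" "y \<preceq> w"
  shows "\<exists>z\<in>carrier M. \<forall>v\<in>carrier M. x \<preceq> v \<and> y \<preceq> v \<longleftrightarrow> z \<preceq> v"
  using assms
proof (induction arbitrary: y w rule: trace_induct)
  case one
  then show ?case by auto
next
  case (letter a x)
  obtain w' where w': "w' \<in> carrier M" "w = letter a \<diamondop> w'" "x \<preceq> w'"
    by (rule letter_mult_leE[OF letter.prems(3) letter.hyps(1,2)])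
  show ?case
  proof (cases "letter a \<preceq> y")
    case True
    then obtain y' where y': "y' \<in> carrier M" "y = letter a \<diamondop> y'"
      by (auto elim: trace_leE)
    have "y' \<preceq> w'"
      using letter.prems(4) letter.hyps(1) y' w' by simp
    then obtain z where z: "z \<in> carrier M" "\<forall>v\<in>carrier M. x \<preceq> v \<and> y' \<preceq> v \<longleftrightarrow> z \<preceq> v"
      using letter.IH[OF y'(1) w'(1) w'(3)] by blast
    have "letter a \<diamondop> x \<preceq> v \<and> y \<preceq> v \<longleftrightarrow> letter a \<diamondop> z \<preceq> v" if v: "v \<in> carrier M" for v
    proof (cases "letter a \<preceq> v")
      case True
      then obtain v' where "v' \<in> carrier M" "v = letter a \<diamondop> v'"
        by (auto elim: trace_leE)
      then show ?thesis
        using letter y' z by auto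
    next
      case False
      then show ?thesis
        using letter.hyps z by (metis letter_carrier mult_carrier trace_le_mult trace_le_trans)
    qed
    then show ?thesis
      using letter.hyps z by blast
  next
    case False
    have y: "independent_of a y" "y \<preceq> w'"
      using not_letter_le_commutes[OF _ _ w'(1), of a y] letter False w' by auto
    obtain z where z: "z \<in> carrier M" "\<forall>v\<in>carrier M. x \<preceq> v \<and> y \<preceq> v \<longleftrightarrow> z \<preceq> v"
      using letter.IH[OF letter.prems(1) w'(1,3) y(2)] by blast
    have "letter a \<diamondop> x \<preceq> v \<and> y \<preceq> v \<longleftrightarrow> letter a \<diamondop> z \<preceq> v" if v: "v \<in> carrier M" for v
    proof (cases "letter a \<preceq> v")
      case True
      then obtain v' where "v' \<in> carrier M" "v = letter a \<diamondop> v'"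
        by (auto elim: trace_leE)
      then show ?thesis
        using letter y z by (auto simp: independent_le_letter_mult)
    next
      case False
      then show ?thesis
        using letter.hyps z by (metis letter_carrier mult_carrier trace_le_mult trace_le_trans)
    qed
    then show ?thesis
      using letter.hyps z by blast
  qed
qed

section \<open>First passages\<close>

text \<open>The same induction as for least common multiples. If the first letter of \<open>x\<close> commutes past \<open>y\<close>, it
is not \<open>c\<close>, and it also commutes past every divisor of \<open>y\<close>.\<close>

lemma common_divisor_with_letter:
  assumes "x \<in> carrier M" "y \<in> carrier M" "w \<in> carrier M" "x \<preceq> w" "y \<preceq> w"
    and "0 < occurrences c x" "0 < occurrences c y"
  shows "\<exists>z\<in>carrier M. z \<preceq> x \<and> z \<preceq> y \<and> 0 < occurrences c z"
  using assms
proof (induction arbitrary: y w rule: trace_induct)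
  case one
  then show ?case by simp
next
  case (letter a x)
  have c: "c \<in> \<Sigma>"
    using letter.prems occurrences_outside by fastforce
  obtain w' where w': "w' \<in> carrier M" "w = letter a \<diamondop> w'" "x \<preceq> w'"
    by (rule letter_mult_leE[OF letter.prems(3) letter.hyps(1,2)])
  show ?case
  proof (cases "letter a \<preceq> y")
    case True
    then obtain y' where y': "y' \<in> carrier M" "y = letter a \<diamondop> y'"
      by (auto elim: trace_leE)
    show ?thesis
    proof (cases "a = c")
      case True
      then show ?thesis
        using letter y' by (intro bexI[of _ "letter a"]) auto
    next
      case False
      have "y' \<preceq> w'" "0 < occurrences c x" "0 < occurrences c y'"
        using letter.prems letter.hyps False y' w' by auto
      then obtain z where "z \<in> carrier M" "z \<preceq> x" "z \<preceq> y'" "0 < occurrences c z"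
        using letter.IH[OF y'(1) w'(1) w'(3)] by blast
      then show ?thesis
        using letter y' by (intro bexI[of _ "letter a \<diamondop> z"]) auto
    qed
  next
    case False
    have y: "independent_of a y" "y \<preceq> w'"
      using not_letter_le_commutes[OF _ _ w'(1), of a y] letter False w' by auto
    have "a \<noteq> c"
      using y(1) c letter.prems indep_irrefl by (auto simp: independent_of_def irrefl_def)
    then have "0 < occurrences c x"
      using letter.prems letter.hyps by simp
    then obtain z where z: "z \<in> carrier M" "z \<preceq> x" "z \<preceq> y" "0 < occurrences c z"
      using letter.IH[OF letter.prems(1) w'(1,3) y(2)] letter.prems by blast
    have "independent_of a z"
      using y(1) unfolding independent_of_def
      by (meson occurrences_mono[OF z(3,1)] less_le_trans)
    then show ?thesis
      using letter z by (intro bexI[of _ z]) (auto simp: independent_le_letter_mult)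
  qed
qed

text \<open>The traces whose only maximal letter is \<open>c\<close> and in which \<open>c\<close> occurs once.\<close>

definition first_passage :: "'a \<Rightarrow> 'a list set set" where
  "first_passage c = {x \<in> carrier M. 0 < occurrences c x \<and>
     (\<forall>y\<in>carrier M. y \<preceq> x \<longrightarrow> 0 < occurrences c y \<longrightarrow> y = x)}"

lemma first_passage_unique:
  assumes "x \<in> first_passage c" "y \<in> first_passage c" "w \<in> carrier M" "x \<preceq> w" "y \<preceq> w"
  shows "x = y"
proof -
  have x: "x \<in> carrier M" "0 < occurrences c x"
    and y: "y \<in> carrier M" "0 < occurrences c y"
    using assms by (auto simp: first_passage_def)
  from common_divisor_with_letter[OF x(1) y(1) assms(3,4,5) x(2) y(2)] show ?thesis
    using assms by (auto simp: first_passage_def)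
qed

lemma first_passage_exists:
  assumes "x \<in> carrier M" "0 < occurrences c x"
  shows "\<exists>v\<in>first_passage c. v \<preceq> x"
proof -
  define P where "P y \<longleftrightarrow> y \<in> carrier M \<and> y \<preceq> x \<and> 0 < occurrences c y" for y
  define v where "v = arg_min trace_length P"
  have "P x" using assms by (simp add: P_def)
  then have v: "P v" "\<And>y. P y \<Longrightarrow> trace_length v \<le> trace_length y"
    unfolding v_def by (auto intro: arg_min_natI arg_min_nat_le)
  have "v \<in> first_passage c"
    unfolding first_passage_def
  proof (intro CollectI conjI ballI impI)
    fix y assume y: "y \<in> carrier M" "y \<preceq> v" "0 < occurrences c y"
    then have "P y"
      using v(1) trace_le_trans[of y v x] by (simp add: P_def)
    then show "y = v"
      using y v by (intro trace_le_same_length) auto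
  qed (use v in \<open>auto simp: P_def\<close>)
  then show ?thesis using v by (auto simp: P_def)
qed

lemma letter_first_passage:
  assumes "a \<in> \<Sigma>"
  shows "letter a \<in> first_passage a"
proof -
  have "y = letter a" if y: "y \<in> carrier M" "y \<preceq> letter a" "0 < occurrences a y" for y
  proof (rule trace_le_same_length)
    have "occurrences a y \<le> trace_length y"
      unfolding trace_length_def using assms finite_alphabet by (intro member_le_sum) auto
    then show "trace_length (letter a) \<le> trace_length y"
      using y assms by simp
  qed (use y in auto)
  then show ?thesis
    using assms by (auto simp: first_passage_def)
qed

section \<open>Cliques and normal forms\<close>

lemma clique_finite: "clique c \<Longrightarrow> finite c"
  using finite_alphabet by (auto simp: clique_def intro: finite_subset)

lemma clique_empty [simp]: "clique {}"
  by (simp add: clique_def)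

lemma clique_subset: "clique c \<Longrightarrow> d \<subseteq> c \<Longrightarrow> clique d"
  by (auto simp: clique_def pairwise_def)

lemma clique_trace_empty [simp]: "clique_trace {} = \<epsilon>"
  using clique_trace_eq[of "{}" "[]"] by (simp add: one_M)

lemma clique_trace_insert:
  assumes "clique (insert a c)" "a \<notin> c"
  shows "clique_trace (insert a c) = letter a \<diamondop> clique_trace c"
proof -
  have c: "clique c" "a \<in> \<Sigma>"
    using assms clique_subset[OF assms(1), of c] by (auto simp: clique_def)
  obtain w where w: "distinct w" "set w = c"
    using finite_distinct_list[OF clique_finite[OF c(1)]] by auto
  moreover have "w \<in> lists \<Sigma>"
    using c w by (auto simp: clique_def)
  ultimately show ?thesis
    using assms c clique_trace_eq[of c w] clique_trace_eq[of "insert a c" "a # w"]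
    by (simp add: mult_trace)
qed

lemma clique_induct [consumes 1, case_names empty insert]:
  assumes "clique c" "P {}"
    "\<And>a c. clique (insert a c) \<Longrightarrow> clique c \<Longrightarrow> a \<in> \<Sigma> \<Longrightarrow> a \<notin> c \<Longrightarrow> P c \<Longrightarrow> P (insert a c)"
  shows "P c"
  using clique_finite[OF assms(1)] assms(1)
proof (induction rule: finite_induct)
  case (insert a c)
  have "clique c" "a \<in> \<Sigma>"
    using insert.prems clique_subset[OF insert.prems, of c] by (auto simp: clique_def)
  then show ?case
    using insert assms(3) by blast
qed (use assms in auto)

lemma clique_trace_carrier [simp, intro]: "clique c \<Longrightarrow> clique_trace c \<in> carrier M"
  by (induction rule: clique_induct) (auto simp: clique_trace_insert)

lemma occurrences_clique_trace: "clique c \<Longrightarrow> occurrences b (clique_trace c) = (if b \<in> c then 1 else 0)"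
  by (induction rule: clique_induct) (auto simp: clique_trace_insert)

lemma clique_trace_inject:
  assumes "clique c" "clique d" "clique_trace c = clique_trace d"
  shows "c = d"
  using occurrences_clique_trace[OF assms(1)] occurrences_clique_trace[OF assms(2)] assms(3)
  by (metis equalityI subsetI zero_neq_one)

lemma independent_of_clique_trace:
  "clique c \<Longrightarrow> independent_of a (clique_trace c) \<longleftrightarrow> (\<forall>b\<in>c. (a, b) \<in> I)"
  by (induction rule: clique_induct) (auto simp: clique_trace_insert)

lemma trace_length_clique_trace: "clique c \<Longrightarrow> trace_length (clique_trace c) = card c"
  by (induction rule: clique_induct) (auto simp: clique_trace_insert clique_finite)

lemma letter_le_clique_trace:
  assumes "clique c" "b \<in> \<Sigma>"
  shows "letter b \<preceq> clique_trace c \<longleftrightarrow> b \<in> c"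
  using assms
proof (induction rule: clique_induct)
  case (insert a c)
  then have "b \<in> c \<Longrightarrow> (b, a) \<in> I"
    by (auto simp: clique_def pairwise_def)
  then show ?case
    using insert by (auto simp: clique_trace_insert letter_le_mult)
qed auto

lemma clique_trace_le:
  assumes "clique c" "x \<in> carrier M" "\<And>a. a \<in> c \<Longrightarrow> letter a \<preceq> x"
  shows "clique_trace c \<preceq> x"
  using assms
proof (induction arbitrary: x rule: clique_induct)
  case (insert a c)
  obtain z where z: "z \<in> carrier M" "x = letter a \<diamondop> z"
    using insert.prems by (auto elim: trace_leE)
  have "letter b \<preceq> z" if "b \<in> c" for b
  proof -
    have "b \<in> \<Sigma>" "b \<noteq> a" "letter b \<preceq> letter a \<diamondop> z"
      using insert that z by (auto simp: clique_def)
    then show ?thesis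
      using letter_le_mult[of b "letter a" z] z insert.hyps by simp
  qed
  then show ?case
    using insert z by (simp add: clique_trace_insert)
qed simp

lemma clique_prod_Nil [simp]: "clique_prod [] = \<epsilon>"
  by (simp add: clique_prod_def)

lemma clique_prod_Cons [simp]: "clique_prod (c # cs) = clique_trace c \<diamondop> clique_prod cs"
  by (simp add: clique_prod_def)

lemma clique_prod_carrier [simp, intro]: "(\<And>c. c \<in> set cs \<Longrightarrow> clique c) \<Longrightarrow> clique_prod cs \<in> carrier M"
  by (induction cs) auto

lemma clique_prod_append [simp]:
  "(\<And>c. c \<in> set cs \<Longrightarrow> clique c) \<Longrightarrow> (\<And>c. c \<in> set ds \<Longrightarrow> clique c) \<Longrightarrow>
    clique_prod (cs @ ds) = clique_prod cs \<diamondop> clique_prod ds"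
  by (induction cs) (auto simp: mult_assoc)

lemma trace_length_clique_prod:
  "(\<And>c. c \<in> set cs \<Longrightarrow> clique c) \<Longrightarrow> trace_length (clique_prod cs) = (\<Sum>c\<leftarrow>cs. card c)"
  by (induction cs) (auto simp: trace_length_clique_trace)

lemma trace_length_clique_prod_le:
  assumes "\<And>c. c \<in> set cs \<Longrightarrow> clique c"
  shows "trace_length (clique_prod cs) \<le> length cs * card \<Sigma>"
proof -
  have "card c \<le> card \<Sigma>" if "c \<in> set cs" for c
    using assms[OF that] finite_alphabet by (auto simp: clique_def intro: card_mono)
  then have "(\<Sum>c\<leftarrow>cs. card c) \<le> (\<Sum>c\<leftarrow>cs. card \<Sigma>)"
    by (intro sum_list_mono)
  then show ?thesis
    using assms by (simp add: trace_length_clique_prod sum_list_triv)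
qed

lemma length_le_trace_length_clique_prod:
  assumes "\<And>c. c \<in> set cs \<Longrightarrow> clique c \<and> c \<noteq> {}"
  shows "length cs \<le> trace_length (clique_prod cs)"
proof -
  have "1 \<le> card c" if "c \<in> set cs" for c
    using assms[OF that] by (simp add: clique_finite Suc_le_eq card_gt_0_iff)
  then have "(\<Sum>c\<leftarrow>cs. 1) \<le> (\<Sum>c\<leftarrow>cs. card c)"
    by (intro sum_list_mono)
  then show ?thesis
    using assms by (simp add: trace_length_clique_prod sum_list_triv)
qed

lemma letter_le_clique_prod:
  assumes "successively clique_arrow cs" "\<And>c. c \<in> set cs \<Longrightarrow> clique c"
    and "b \<in> \<Sigma>" "letter b \<preceq> clique_prod cs"
  shows "cs \<noteq> [] \<and> b \<in> hd cs"
  using assms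
proof (induction cs)
  case (Cons c cs)
  have c: "clique c" and cs: "clique_prod cs \<in> carrier M"
    using Cons.prems by auto
  have "letter b \<preceq> clique_trace c \<or> independent_of b (clique_trace c) \<and> letter b \<preceq> clique_prod cs"
    using Cons.prems c cs by (simp add: letter_le_mult)
  then show ?case
  proof
    assume *: "independent_of b (clique_trace c) \<and> letter b \<preceq> clique_prod cs"
    then have "cs \<noteq> []" "b \<in> hd cs"
      using Cons by (auto simp: successively_Cons)
    then obtain a where "a \<in> c" "(a, b) \<notin> I"
      using Cons.prems(1) by (auto simp: successively_Cons clique_arrow_def)
    then show ?thesis
      using * c indep_sym by (auto simp: independent_of_clique_trace dest: symD)
  qed (use Cons.prems c in \<open>auto simp: letter_le_clique_trace\<close>)
qed simp

text \<open>The greedy character of normal forms. By induction \<open>ds\<close> without its last clique \<open>d\<close> divides the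
first cliques of \<open>cs\<close>, with quotient \<open>z\<close> say. A letter of \<open>d\<close> that does not divide \<open>z\<close> times the next
clique \<open>c\<close> of \<open>cs\<close> would commute past \<open>c\<close> and lie in the clique after \<open>c\<close>, against the arrow between
these two.\<close>

lemma clique_prod_le_take:
  assumes "successively clique_arrow cs" "\<And>c. c \<in> set cs \<Longrightarrow> clique c"
    and "\<And>d. d \<in> set ds \<Longrightarrow> clique d" "clique_prod ds \<preceq> clique_prod cs"
  shows "clique_prod ds \<preceq> clique_prod (take (length ds) cs)"
  using assms(3,4)
proof (induction ds rule: rev_induct)
  case (snoc d ds)
  have ds: "clique_prod ds \<in> carrier M" and d: "clique d" "clique_trace d \<in> carrier M"
    using snoc.prems by auto
  have eq: "clique_prod (ds @ [d]) = clique_prod ds \<diamondop> clique_trace d"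
    using snoc.prems by (subst clique_prod_append) auto
  have take: "\<And>n. clique_prod (take n cs) \<in> carrier M" "\<And>n. clique_prod (drop n cs) \<in> carrier M"
    using assms(2) by (auto dest: in_set_takeD in_set_dropD)
  show ?case
  proof (cases "length ds < length cs")
    case False
    then show ?thesis using snoc.prems by simp
  next
    case True
    define c where "c = cs ! length ds"
    define rest where "rest = drop (Suc (length ds)) cs"
    have c: "clique c" "clique_trace c \<in> carrier M"
      using assms(2) True by (auto simp: c_def)
    have "clique_prod ds \<preceq> clique_prod cs"
      using snoc.prems ds d eq by (metis trace_le_mult trace_le_trans)
    then have "clique_prod ds \<preceq> clique_prod (take (length ds) cs)"
      using snoc by simp
    then obtain z where z: "z \<in> carrier M" "clique_prod (take (length ds) cs) = clique_prod ds \<diamondop> z"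
      by (auto elim: trace_leE)
    have take_Suc: "clique_prod (take (Suc (length ds)) cs) = clique_prod ds \<diamondop> (z \<diamondop> clique_trace c)"
    proof -
      have "clique_prod (take (Suc (length ds)) cs) = clique_prod (take (length ds) cs) \<diamondop> clique_trace c"
        using assms(2) True c unfolding c_def
        by (subst take_Suc_conv_app_nth[OF True], subst clique_prod_append) (auto dest: in_set_takeD)
      then show ?thesis
        using z ds c by (simp add: mult_assoc)
    qed
    have rest: "clique_prod rest \<in> carrier M"
      using take by (simp add: rest_def)
    have "clique_prod cs = clique_prod ds \<diamondop> (z \<diamondop> clique_trace c \<diamondop> clique_prod rest)"
    proof -
      have "clique_prod cs = clique_prod (take (Suc (length ds)) cs) \<diamondop> clique_prod rest"
        unfolding rest_def
        by (subst clique_prod_append[symmetric]) (auto dest: in_set_takeD in_set_dropD assms(2))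
      then show ?thesis
        using take_Suc ds z c rest by (simp add: mult_assoc)
    qed
    then have d_le: "clique_trace d \<preceq> z \<diamondop> clique_trace c \<diamondop> clique_prod rest"
      using snoc.prems(2) eq ds d z c rest by simp
    have "letter b \<preceq> z \<diamondop> clique_trace c" if "b \<in> d" for b
    proof -
      have b: "b \<in> \<Sigma>"
        using that d by (auto simp: clique_def)
      have "letter b \<preceq> clique_trace d"
        using b d that by (simp add: letter_le_clique_trace)
      then have "letter b \<preceq> z \<diamondop> clique_trace c \<diamondop> clique_prod rest"
        using d_le trace_le_trans[of "letter b"] b by blast
      then have "letter b \<preceq> z \<diamondop> clique_trace c \<or>
          independent_of b (z \<diamondop> clique_trace c) \<and> letter b \<preceq> clique_prod rest"
        using b z c rest by (simp add: letter_le_mult)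
      then show ?thesis
      proof
        assume *: "independent_of b (z \<diamondop> clique_trace c) \<and> letter b \<preceq> clique_prod rest"
        have cs: "drop (length ds) cs = c # rest"
          using True by (simp add: c_def rest_def Cons_nth_drop_Suc)
        have "successively clique_arrow (c # rest)"
          using assms(1) unfolding cs[symmetric]
          by (metis append_take_drop_id successively_append_iff)
        then have "successively clique_arrow rest" "rest \<noteq> [] \<Longrightarrow> clique_arrow c (hd rest)"
          by (auto simp: successively_Cons)
        moreover have "rest \<noteq> [] \<and> b \<in> hd rest"
          using * b calculation(1) assms(2)
          by (intro letter_le_clique_prod) (auto simp: rest_def dest: in_set_dropD)
        ultimately obtain a where "a \<in> c" "(a, b) \<notin> I"
          by (auto simp: clique_arrow_def)
        then show ?thesis
          using * z c indep_sym by (auto simp: independent_of_clique_trace dest: symD)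
      qed
    qed
    then have "clique_trace d \<preceq> z \<diamondop> clique_trace c"
      using d z c by (intro clique_trace_le) auto
    then show ?thesis
      using eq take_Suc ds d z c by simp
  qed
qed simp

lemma clique_prod_take_le:
  assumes "\<And>c. c \<in> set cs \<Longrightarrow> clique c" "m \<le> n"
  shows "clique_prod (take m cs) \<preceq> clique_prod (take n cs)"
proof -
  have "take n cs = take m cs @ drop m (take n cs)"
    using assms(2) by (metis append_take_drop_id min.absorb1 take_take)
  moreover have "\<And>c. c \<in> set (take m cs) \<Longrightarrow> clique c" "\<And>c. c \<in> set (drop m (take n cs)) \<Longrightarrow> clique c"
    using assms(1) by (auto dest: in_set_takeD in_set_dropD)
  ultimately show ?thesis
    by (metis clique_prod_append clique_prod_carrier trace_le_mult)
qed

definition traces_of_height :: "nat \<Rightarrow> 'a list set set" where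
  "traces_of_height n = clique_prod ` {ds. set ds \<subseteq> {c. clique c} \<and> length ds \<le> n}"

lemma finite_traces_of_height: "finite (traces_of_height n)"
proof -
  have "finite {c. clique c}"
    using finite_alphabet by (rule_tac finite_subset[of _ "Pow \<Sigma>"]) (auto simp: clique_def)
  then show ?thesis
    unfolding traces_of_height_def by (intro finite_imageI finite_lists_length_le)
qed

lemma traces_of_height_carrier: "traces_of_height n \<subseteq> carrier M"
  by (auto simp: traces_of_height_def)

lemma trace_length_height:
  assumes "x \<in> traces_of_height n"
  shows "trace_length x \<le> n * card \<Sigma>"
proof -
  obtain ds where ds: "x = clique_prod ds" "set ds \<subseteq> {c. clique c}" "length ds \<le> n"
    using assms by (auto simp: traces_of_height_def)
  have "trace_length x \<le> length ds * card \<Sigma>"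
    using ds trace_length_clique_prod_le[of ds] by auto
  also have "\<dots> \<le> n * card \<Sigma>"
    using ds by simp
  finally show ?thesis .
qed

lemma normal_form_height:
  assumes "normal_form x cs"
  shows "clique_prod (take n cs) \<in> traces_of_height n" "clique_prod (take n cs) \<preceq> x"
    and "y \<in> traces_of_height n \<Longrightarrow> y \<preceq> x \<Longrightarrow> y \<preceq> clique_prod (take n cs)"
proof -
  have cs: "\<And>c. c \<in> set cs \<Longrightarrow> clique c" "successively clique_arrow cs" "x = clique_prod cs"
    using assms by (auto simp: normal_form_def)
  show "clique_prod (take n cs) \<in> traces_of_height n"
    unfolding traces_of_height_def using cs by (intro imageI) (auto dest: in_set_takeD)
  show "clique_prod (take n cs) \<preceq> x"
    using clique_prod_take_le[of cs n "max n (length cs)"] cs by simp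
  assume "y \<in> traces_of_height n" "y \<preceq> x"
  then obtain ds where ds: "y = clique_prod ds" "\<And>d. d \<in> set ds \<Longrightarrow> clique d" "length ds \<le> n"
    by (auto simp: traces_of_height_def)
  have "y \<preceq> clique_prod (take (length ds) cs)"
    using clique_prod_le_take[OF cs(2,1) ds(2)] \<open>y \<preceq> x\<close> ds cs by simp
  also have "clique_prod (take (length ds) cs) \<preceq> clique_prod (take n cs)"
    using cs(1) ds(3) by (rule clique_prod_take_le)
  finally show "y \<preceq> clique_prod (take n cs)"
    using ds by auto
qed

text \<open>For every \<open>n\<close> the first \<open>n\<close> cliques of either normal form multiply to the greatest divisor of
height at most \<open>n\<close>, so the products agree; cancel to compare the cliques one by one.\<close>

lemma normal_form_unique:
  assumes "normal_form x cs" "normal_form x ds"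
  shows "cs = ds"
proof -
  have carrier: "clique_prod (take n es) \<in> carrier M" if "normal_form x es" for n es
    using normal_form_height(1)[OF that] traces_of_height_carrier by blast
  have eq: "clique_prod (take n cs) = clique_prod (take n ds)" for n
    using assms normal_form_height carrier by (intro trace_le_antisym) auto
  have len: "length as \<le> length bs"
    if as: "normal_form x as" and bs: "normal_form x bs"
      and "\<And>n. clique_prod (take n as) = clique_prod (take n bs)" for as bs
  proof (rule ccontr)
    assume "\<not> length as \<le> length bs"
    then have less: "length bs < length as" by simp
    define ts where "ts = drop (length bs) as"
    have as': "\<And>c. c \<in> set as \<Longrightarrow> clique c \<and> c \<noteq> {}" "clique_prod as = x"
      using as by (auto simp: normal_form_def)
    have "clique_prod (take (length bs) as @ ts) = clique_prod (take (length bs) as) \<diamondop> clique_prod ts"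
      using as' by (intro clique_prod_append) (auto simp: ts_def dest: in_set_takeD in_set_dropD)
    moreover have "take (length bs) as @ ts = as"
      by (simp add: ts_def)
    ultimately have "x = x \<diamondop> clique_prod ts"
      using that(3)[of "length bs"] as' bs by (simp add: normal_form_def)
    moreover have "x \<in> carrier M" "clique_prod ts \<in> carrier M"
      using as' by (auto simp: ts_def dest: in_set_dropD)
    ultimately have "trace_length (clique_prod ts) = 0"
      by (metis add_cancel_right_right trace_length_mult)
    then show False
      using length_le_trace_length_clique_prod[of ts] less as' by (auto simp: ts_def dest: in_set_dropD)
  qed
  have "length cs = length ds"
    using len[OF assms] len[OF assms(2,1)] eq by (simp add: order_antisym)
  moreover have "cs ! i = ds ! i" if i: "i < length cs" for i
  proof (rule clique_trace_inject)
    have cliques: "\<And>c. c \<in> set cs \<Longrightarrow> clique c" "\<And>c. c \<in> set ds \<Longrightarrow> clique c"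
      using assms by (auto simp: normal_form_def)
    then show c: "clique (cs ! i)" "clique (ds ! i)"
      using i calculation by auto
    have "clique_prod (take (Suc i) cs) = clique_prod (take i cs) \<diamondop> clique_trace (cs ! i)"
      using cliques c i by (subst take_Suc_conv_app_nth[OF i], subst clique_prod_append) (auto dest: in_set_takeD)
    moreover have "clique_prod (take (Suc i) ds) = clique_prod (take i ds) \<diamondop> clique_trace (ds ! i)"
      using cliques c i \<open>length cs = length ds\<close>
      by (subst take_Suc_conv_app_nth, simp, subst clique_prod_append) (auto dest: in_set_takeD)
    ultimately have "clique_prod (take i cs) \<diamondop> clique_trace (cs ! i) = clique_prod (take i cs) \<diamondop> clique_trace (ds ! i)"
      by (simp only: eq)
    from mult_left_cancel[OF _ _ _ this] show "clique_trace (cs ! i) = clique_trace (ds ! i)"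
      using carrier[OF assms(1), of i] c by simp
  qed
  ultimately show ?thesis
    by (simp add: nth_equalityI)
qed

text \<open>The first clique consists of all minimal letters.\<close>

lemma normal_form_exists:
  assumes "x \<in> carrier M"
  shows "\<exists>cs. normal_form x cs"
  using assms
proof (induction "trace_length x" arbitrary: x rule: less_induct)
  case less
  show ?case
  proof (cases "x = \<epsilon>")
    case True
    then show ?thesis by (intro exI[of _ "[]"]) (simp add: normal_form_def)
  next
    case False
    define c where "c = {a \<in> \<Sigma>. letter a \<preceq> x}"
    have c: "clique c"
      unfolding clique_def pairwise_def
    proof (intro conjI ballI impI)
      fix a b assume ab: "a \<in> c" "b \<in> c" "a \<noteq> b"
      obtain z where z: "z \<in> carrier M" "x = letter b \<diamondop> z"
        using ab by (auto simp: c_def elim: trace_leE)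
      then show "(a, b) \<in> I"
        using ab letter_le_mult[of a "letter b" z] by (auto simp: c_def)
    qed (auto simp: c_def)
    have "c \<noteq> {}"
      using minimal_letter_exists[OF less.prems False] by (auto simp: c_def)
    have "clique_trace c \<preceq> x"
      using less.prems c by (intro clique_trace_le) (auto simp: c_def)
    then obtain z where z: "z \<in> carrier M" "x = clique_trace c \<diamondop> z"
      by (auto elim: trace_leE)
    then have "trace_length z < trace_length x"
      using c \<open>c \<noteq> {}\<close> by (simp add: trace_length_clique_trace card_gt_0_iff clique_finite)
    then obtain cs where cs: "normal_form z cs"
      using less.hyps z by blast
    have "clique_arrow c (hd cs)" if "cs \<noteq> []"
      unfolding clique_arrow_def
    proof (intro ballI, rule ccontr)
      fix b assume b: "b \<in> hd cs" "\<not> (\<exists>a\<in>c. (a, b) \<notin> I)"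
      have hd: "clique (hd cs)" "clique_prod (tl cs) \<in> carrier M" "z = clique_trace (hd cs) \<diamondop> clique_prod (tl cs)"
        using that cs by (cases cs; auto simp: normal_form_def)+
      have "b \<in> \<Sigma>"
        using b hd by (auto simp: clique_def)
      then have "letter b \<preceq> z"
        using b hd by (simp add: letter_le_mult letter_le_clique_trace)
      moreover have "independent_of b (clique_trace c)"
        using b c indep_sym by (auto simp: independent_of_clique_trace dest: symD)
      ultimately have "letter b \<preceq> x"
        using \<open>b \<in> \<Sigma>\<close> z c by (simp add: letter_le_mult)
      then have "b \<in> c"
        using \<open>b \<in> \<Sigma>\<close> by (simp add: c_def)
      then show False
        using b indep_irrefl by (auto simp: irrefl_def)
    qed
    then have "normal_form x (c # cs)"
      using cs c \<open>c \<noteq> {}\<close> z by (auto simp: normal_form_def successively_Cons)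
    then show ?thesis ..
  qed
qed

definition nf :: "'a list set \<Rightarrow> 'a set list" where
  "nf x = (THE cs. normal_form x cs)"

lemma normal_form_nf: "x \<in> carrier M \<Longrightarrow> normal_form x (nf x)"
  unfolding nf_def
  by (rule theI', rule ex_ex1I) (erule normal_form_exists, erule normal_form_unique)

lemma nf_eq: "normal_form x cs \<Longrightarrow> nf x = cs"
  unfolding nf_def by (rule the_equality) (auto dest: normal_form_unique)

lemma trace_clique_nf: "trace_clique i x = (if i < length (nf x) then nf x ! i else {})"
  by (simp add: trace_clique_def nf_def)

text \<open>The greatest divisor of \<open>x\<close> that is a product of at most \<open>n\<close> cliques.\<close>

definition truncate :: "nat \<Rightarrow> 'a list set \<Rightarrow> 'a list set" where
  "truncate n x = clique_prod (take n (nf x))"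

lemma truncate_carrier [simp, intro]: "x \<in> carrier M \<Longrightarrow> truncate n x \<in> carrier M"
  unfolding truncate_def using normal_form_height(1)[OF normal_form_nf] traces_of_height_carrier by blast

lemma truncate_height: "x \<in> carrier M \<Longrightarrow> truncate n x \<in> traces_of_height n"
  unfolding truncate_def using normal_form_height(1)[OF normal_form_nf] .

lemma truncate_le: "x \<in> carrier M \<Longrightarrow> truncate n x \<preceq> x"
  unfolding truncate_def using normal_form_height(2)[OF normal_form_nf] .

lemma le_truncate: "x \<in> carrier M \<Longrightarrow> y \<in> traces_of_height n \<Longrightarrow> y \<preceq> x \<Longrightarrow> y \<preceq> truncate n x"
  unfolding truncate_def using normal_form_height(3)[OF normal_form_nf] .

lemma truncate_mono:
  assumes "x \<in> carrier M" "y \<in> carrier M" "x \<preceq> y"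
  shows "truncate n x \<preceq> truncate n y"
  using assms truncate_le[of x n] trace_le_trans[of "truncate n x" x y]
  by (intro le_truncate truncate_height) auto

lemma in_traces_of_height: "x \<in> carrier M \<Longrightarrow> \<exists>n. x \<in> traces_of_height n"
  using normal_form_height(1)[OF normal_form_nf, of x "length (nf x)"] normal_form_nf[of x]
  by (auto simp: normal_form_def)

lemma clique_trace_clique: "x \<in> carrier M \<Longrightarrow> clique (trace_clique i x)"
  using normal_form_nf[of x] by (auto simp: trace_clique_nf normal_form_def)

lemma truncate_Suc:
  assumes "x \<in> carrier M"
  shows "truncate (Suc i) x = truncate i x \<diamondop> clique_trace (trace_clique i x)"
proof (cases "i < length (nf x)")
  case True
  have "\<And>c. c \<in> set (nf x) \<Longrightarrow> clique c"
    using normal_form_nf[OF assms] by (auto simp: normal_form_def)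
  then show ?thesis
    unfolding truncate_def using True
    by (subst take_Suc_conv_app_nth[OF True], subst clique_prod_append)
       (auto simp: trace_clique_nf dest: in_set_takeD)
next
  case False
  then show ?thesis
    using truncate_carrier[OF assms, of i] by (simp add: truncate_def trace_clique_nf)
qed

lemma clique_arrow_trace_clique:
  assumes "x \<in> carrier M"
  shows "clique_arrow (trace_clique i x) (trace_clique (Suc i) x)"
  using normal_form_nf[OF assms]
  by (auto simp: trace_clique_nf normal_form_def successively_conv_nth clique_arrow_def)

lemma trace_clique_nonempty:
  assumes "x \<in> carrier M" "i * card \<Sigma> < trace_length x"
  shows "trace_clique i x \<noteq> {}"
proof -
  have nf: "\<And>c. c \<in> set (nf x) \<Longrightarrow> clique c \<and> c \<noteq> {}" "clique_prod (nf x) = x"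
    using normal_form_nf[OF assms(1)] by (auto simp: normal_form_def)
  have "trace_length x \<le> length (nf x) * card \<Sigma>"
    using trace_length_clique_prod_le[of "nf x"] nf by auto
  then have "i < length (nf x)"
    using assms(2) by (metis leD le_less_trans mult_le_mono1 not_le_imp_less)
  then show ?thesis
    using nf by (simp add: trace_clique_nf)
qed

section \<open>Infinite traces as suprema of finite traces\<close>

lemma boundary_clique: "\<omega> \<in> boundary \<Longrightarrow> clique (\<omega> i)"
  by (simp add: boundary_def)

lemma prefix_0 [simp]: "prefix \<omega> 0 = \<epsilon>"
  by (simp add: prefix_def)

lemma prefix_carrier [simp, intro]: "\<omega> \<in> boundary \<Longrightarrow> prefix \<omega> n \<in> carrier M"
  unfolding prefix_def by (intro clique_prod_carrier) (auto simp: boundary_clique)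

lemma prefix_Suc: "\<omega> \<in> boundary \<Longrightarrow> prefix \<omega> (Suc n) = prefix \<omega> n \<diamondop> clique_trace (\<omega> n)"
  unfolding prefix_def by (simp, subst clique_prod_append) (auto simp: boundary_clique)

lemma prefix_mono:
  assumes "\<omega> \<in> boundary" "m \<le> n"
  shows "prefix \<omega> m \<preceq> prefix \<omega> n"
  using assms(2)
proof (induction rule: dec_induct)
  case (step n)
  have "prefix \<omega> n \<preceq> prefix \<omega> (Suc n)"
    using assms by (simp add: prefix_Suc boundary_clique)
  with step show ?case
    using assms trace_le_trans[of "prefix \<omega> m" "prefix \<omega> n"] by simp
qed (use assms in auto)

lemma normal_form_prefix:
  assumes "\<omega> \<in> boundary"
  shows "normal_form (prefix \<omega> n) (map \<omega> [0..<n])"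
  using assms unfolding normal_form_def prefix_def
  by (auto simp: boundary_def successively_conv_nth)

lemma trace_clique_prefix: "\<omega> \<in> boundary \<Longrightarrow> i < n \<Longrightarrow> trace_clique i (prefix \<omega> n) = \<omega> i"
  by (simp add: trace_clique_nf nf_eq[OF normal_form_prefix])

lemma truncate_prefix: "\<omega> \<in> boundary \<Longrightarrow> m \<le> n \<Longrightarrow> truncate m (prefix \<omega> n) = prefix \<omega> m"
  unfolding truncate_def nf_eq[OF normal_form_prefix] by (simp add: take_map prefix_def)

lemma prefix_height: "\<omega> \<in> boundary \<Longrightarrow> prefix \<omega> n \<in> traces_of_height n"
  using truncate_height[of "prefix \<omega> n" n] by (simp add: truncate_prefix)

lemma length_prefix: "\<omega> \<in> boundary \<Longrightarrow> n \<le> trace_length (prefix \<omega> n)"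
  using length_le_trace_length_clique_prod[of "map \<omega> [0..<n]"]
  by (auto simp: prefix_def boundary_def)

lemma below_prefix [simp]: "\<omega> \<in> boundary \<Longrightarrow> below (prefix \<omega> n) \<omega>"
  unfolding below_def by (auto intro: exI[of _ n])

text \<open>Turns the unbounded search for a prefix into a bounded one; in particular \<open>prefix \<omega> n\<close> is the greatest
trace of height at most \<open>n\<close> below \<open>\<omega>\<close>.\<close>

lemma below_height:
  assumes "\<omega> \<in> boundary" "y \<in> traces_of_height n"
  shows "below y \<omega> \<longleftrightarrow> y \<preceq> prefix \<omega> n"
proof
  assume "below y \<omega>"
  then obtain m where m: "y \<preceq> prefix \<omega> m"
    by (auto simp: below_def)
  have y: "y \<in> carrier M"
    using assms traces_of_height_carrier by blast
  have "y \<preceq> prefix \<omega> (max m n)"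
    using m y assms(1) prefix_mono[of \<omega> m "max m n"] trace_le_trans[of y] by auto
  then have "y \<preceq> truncate n (prefix \<omega> (max m n))"
    using assms by (intro le_truncate) auto
  then show "y \<preceq> prefix \<omega> n"
    using assms by (simp add: truncate_prefix)
qed (auto simp: below_def)

lemma below_common:
  assumes "\<omega> \<in> boundary" "x \<in> carrier M" "y \<in> carrier M" "below x \<omega>" "below y \<omega>"
  obtains n where "x \<preceq> prefix \<omega> n" "y \<preceq> prefix \<omega> n"
proof -
  obtain m n where "x \<preceq> prefix \<omega> m" "y \<preceq> prefix \<omega> n"
    using assms by (auto simp: below_def)
  then have "x \<preceq> prefix \<omega> (max m n)" "y \<preceq> prefix \<omega> (max m n)"
    using assms prefix_mono[of \<omega> _ "max m n"] trace_le_trans[of x] trace_le_trans[of y]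
    by (metis max.cobounded1, metis max.cobounded2)
  then show thesis by (rule that)
qed

lemma below_mono:
  "below y \<omega> \<Longrightarrow> x \<preceq> y \<Longrightarrow> x \<in> carrier M \<Longrightarrow> below x \<omega>"
  unfolding below_def using trace_le_trans by blast

lemma boundary_eqI:
  assumes "\<omega> \<in> boundary" "\<omega>' \<in> boundary" "\<And>y. y \<in> carrier M \<Longrightarrow> below y \<omega> \<longleftrightarrow> below y \<omega>'"
  shows "\<omega> = \<omega>'"
proof
  fix i
  have "prefix \<omega> n = prefix \<omega>' n" for n
  proof (rule trace_le_antisym)
    show "prefix \<omega> n \<preceq> prefix \<omega>' n"
      using assms(1,2) assms(3)[of "prefix \<omega> n"] by (subst below_height[symmetric]) (auto simp: prefix_height)
    show "prefix \<omega>' n \<preceq> prefix \<omega> n"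
      using assms(1,2) assms(3)[of "prefix \<omega>' n"] by (subst below_height[symmetric]) (auto simp: prefix_height)
  qed (use assms in auto)
  then show "\<omega> i = \<omega>' i"
    using trace_clique_prefix[OF assms(1), of i "Suc i"] trace_clique_prefix[OF assms(2), of i "Suc i"]
    by simp
qed

text \<open>The truncations of height \<open>i\<close> of the given traces increase and have bounded length, hence
stabilize; the differences of consecutive limits are the cliques of the supremum. The middle conclusion
matches the pointwise definition of concatenation.\<close>

lemma supremum_of_traces:
  assumes y: "\<And>n. y n \<in> carrier M" "\<And>n. y n \<preceq> y (Suc n)" "\<And>k. \<exists>n. k \<le> trace_length (y n)"
  obtains \<omega> where "\<omega> \<in> boundary"
    "\<And>i. \<forall>\<^sub>F n in sequentially. trace_clique i (y n) = \<omega> i"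
    "\<And>x. x \<in> carrier M \<Longrightarrow> below x \<omega> \<longleftrightarrow> (\<exists>n. x \<preceq> y n)"
proof -
  have mono: "y m \<preceq> y n" if "m \<le> n" for m n
    using that
  proof (induction rule: dec_induct)
    case (step n)
    then show ?case using y trace_le_trans[of "y m" "y n" "y (Suc n)"] by simp
  qed (use y in auto)
  have stable: "\<exists>N. \<forall>n\<ge>N. truncate i (y n) = truncate i (y N)" for i
  proof -
    \<comment> \<open>Take a truncation of maximal length.\<close>
    define S where "S = range (\<lambda>n. trace_length (truncate i (y n)))"
    have fin: "finite S"
      using trace_length_height[OF truncate_height[OF y(1)]]
      by (intro finite_subset[of S "{..i * card \<Sigma>}"]) (auto simp: S_def)
    then have "Max S \<in> S"
      by (intro Max_in) (auto simp: S_def)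
    then obtain N where N: "Max S = trace_length (truncate i (y N))"
      by (auto simp: S_def)
    have "truncate i (y N) = truncate i (y n)" if "N \<le> n" for n
    proof (rule trace_le_same_length)
      show "truncate i (y N) \<preceq> truncate i (y n)"
        using mono[OF that] y by (intro truncate_mono) auto
      show "trace_length (truncate i (y n)) \<le> trace_length (truncate i (y N))"
        unfolding N[symmetric] using fin by (intro Max_ge) (auto simp: S_def)
    qed (use y in auto)
    then show ?thesis by metis
  qed
  then obtain N where N: "\<And>i n. N i \<le> n \<Longrightarrow> truncate i (y n) = truncate i (y (N i))"
    by metis
  define \<omega> where "\<omega> i = trace_clique i (y (max (N i) (N (Suc i))))" for i
  have clique_eq: "trace_clique i (y n) = \<omega> i" if "max (N i) (N (Suc i)) \<le> n" for i n
  proof -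
    let ?m = "max (N i) (N (Suc i))"
    have "truncate i (y n) = truncate i (y ?m)" "truncate (Suc i) (y n) = truncate (Suc i) (y ?m)"
      using N[of i n] N[of i ?m] N[of "Suc i" n] N[of "Suc i" ?m] that by auto
    then have "truncate i (y n) \<diamondop> clique_trace (trace_clique i (y n)) =
        truncate i (y n) \<diamondop> clique_trace (trace_clique i (y ?m))"
      using truncate_Suc[OF y(1)] by metis
    from mult_left_cancel[OF _ _ _ this]
    have "clique_trace (trace_clique i (y n)) = clique_trace (trace_clique i (y ?m))"
      by (simp add: y(1) clique_trace_clique)
    then show ?thesis
      unfolding \<omega>_def by (intro clique_trace_inject clique_trace_clique y(1))
  qed
  have ev: "\<forall>\<^sub>F n in sequentially. trace_clique i (y n) = \<omega> i" for i
    using clique_eq eventually_sequentially by blast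
  have "\<omega> \<in> boundary"
    unfolding boundary_def
  proof (intro CollectI allI conjI)
    fix i
    obtain m where m: "i * card \<Sigma> < trace_length (y m)"
      using y(3)[of "Suc (i * card \<Sigma>)"] Suc_le_lessD by blast
    have *: "\<forall>\<^sub>F n in sequentially. trace_clique i (y n) = \<omega> i \<and> trace_clique (Suc i) (y n) = \<omega> (Suc i) \<and> m \<le> n"
      using ev[of i] ev[of "Suc i"] eventually_ge_at_top[of m] by eventually_elim auto
    obtain n where n: "trace_clique i (y n) = \<omega> i" "trace_clique (Suc i) (y n) = \<omega> (Suc i)" "m \<le> n"
      using eventually_happens'[OF sequentially_bot *] by blast
    have "trace_length (y m) \<le> trace_length (y n)"
      using mono[OF n(3)] y by (intro trace_length_mono) auto
    then show "clique (\<omega> i)" "\<omega> i \<noteq> {}" "clique_arrow (\<omega> i) (\<omega> (Suc i))"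
      using m n y clique_trace_clique[of "y n" i] trace_clique_nonempty[of "y n" i]
        clique_arrow_trace_clique[of "y n" i] by auto
  qed
  have prefix_ev: "\<forall>\<^sub>F n in sequentially. prefix \<omega> i = truncate i (y n)" for i
  proof (induction i)
    case 0
    then show ?case by (simp add: truncate_def)
  next
    case (Suc i)
    then show ?case
      using ev[of i]
      by eventually_elim (simp add: truncate_Suc y prefix_Suc \<open>\<omega> \<in> boundary\<close>)
  qed
  have "below x \<omega> \<longleftrightarrow> (\<exists>n. x \<preceq> y n)" if x: "x \<in> carrier M" for x
  proof
    assume "below x \<omega>"
    then obtain i where "x \<preceq> prefix \<omega> i"
      by (auto simp: below_def)
    moreover obtain n where "prefix \<omega> i = truncate i (y n)"
      using eventually_happens'[OF sequentially_bot prefix_ev[of i]] by blast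
    ultimately show "\<exists>n. x \<preceq> y n"
      using x y truncate_le[of "y n" i] trace_le_trans[of x] by metis
  next
    assume "\<exists>n. x \<preceq> y n"
    then obtain m where m: "x \<preceq> y m" ..
    obtain i where i: "x \<in> traces_of_height i"
      using in_traces_of_height x by blast
    have *: "\<forall>\<^sub>F n in sequentially. prefix \<omega> i = truncate i (y n) \<and> m \<le> n"
      using prefix_ev[of i] eventually_ge_at_top[of m] by eventually_elim auto
    obtain n where n: "prefix \<omega> i = truncate i (y n)" "m \<le> n"
      using eventually_happens'[OF sequentially_bot *] by blast
    have "x \<preceq> y n"
      using trace_le_trans[OF m mono[OF n(2)] x] .
    then have "x \<preceq> prefix \<omega> i"
      using n y i by (simp add: le_truncate)
    then show "below x \<omega>"
      by (auto simp: below_def)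
  qed
  with \<open>\<omega> \<in> boundary\<close> ev show thesis
    by (rule that)
qed

lemma concat_inf:
  assumes "x \<in> carrier M" "\<xi> \<in> boundary"
  shows concat_inf_boundary: "concat_inf x \<xi> \<in> boundary"
    and below_concat_inf: "\<And>y. y \<in> carrier M \<Longrightarrow> below y (concat_inf x \<xi>) \<longleftrightarrow> (\<exists>n. y \<preceq> x \<diamondop> prefix \<xi> n)"
proof -
  obtain \<omega> where \<omega>: "\<omega> \<in> boundary"
    "\<And>i. \<forall>\<^sub>F n in sequentially. trace_clique i (x \<diamondop> prefix \<xi> n) = \<omega> i"
    "\<And>y. y \<in> carrier M \<Longrightarrow> below y \<omega> \<longleftrightarrow> (\<exists>n. y \<preceq> x \<diamondop> prefix \<xi> n)"
  proof (rule supremum_of_traces[of "\<lambda>n. x \<diamondop> prefix \<xi> n"])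
    show "x \<diamondop> prefix \<xi> n \<preceq> x \<diamondop> prefix \<xi> (Suc n)" for n
      using assms prefix_mono[of \<xi> n "Suc n"] by simp
    show "\<exists>n. k \<le> trace_length (x \<diamondop> prefix \<xi> n)" for k
      using assms length_prefix[OF assms(2), of k] by (intro exI[of _ k]) simp
  qed (use assms in auto)
  have "concat_inf x \<xi> = \<omega>"
  proof
    fix i
    have "c = \<omega> i" if "\<forall>\<^sub>F n in sequentially. trace_clique i (x \<diamondop> prefix \<xi> n) = c" for c
    proof -
      have "\<forall>\<^sub>F n in sequentially. c = \<omega> i"
        using that \<omega>(2)[of i] by eventually_elim simp
      then show ?thesis by simp
    qed
    then show "concat_inf x \<xi> i = \<omega> i"
      unfolding concat_inf_def using \<omega>(2)[of i] by (intro the_equality)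
  qed
  with \<omega> show "concat_inf x \<xi> \<in> boundary"
    "\<And>y. y \<in> carrier M \<Longrightarrow> below y (concat_inf x \<xi>) \<longleftrightarrow> (\<exists>n. y \<preceq> x \<diamondop> prefix \<xi> n)"
    by auto
qed

text \<open>The quotients of the long prefixes of \<open>\<omega>\<close> by \<open>x\<close> increase, and their supremum is the residual.\<close>

lemma residual:
  assumes "x \<in> carrier M" "\<omega> \<in> boundary" "below x \<omega>"
  shows residual_boundary: "residual x \<omega> \<in> boundary"
    and below_residual: "\<And>y. y \<in> carrier M \<Longrightarrow> below y (residual x \<omega>) \<longleftrightarrow> below (x \<diamondop> y) \<omega>"
proof -
  have below_shift: "below y \<xi> \<longleftrightarrow> below (x \<diamondop> y) (concat_inf x \<xi>)"
    if "\<xi> \<in> boundary" "y \<in> carrier M" for \<xi> y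
    using that assms by (subst below_concat_inf) (auto simp: below_def)
  obtain N where N: "x \<preceq> prefix \<omega> N"
    using assms by (auto simp: below_def)
  have "\<exists>z\<in>carrier M. prefix \<omega> (N + n) = x \<diamondop> z" for n
  proof -
    have "x \<preceq> prefix \<omega> (N + n)"
      using N assms prefix_mono[of \<omega> N "N + n"] trace_le_trans[of x] by auto
    then show ?thesis by (simp add: factor_def)
  qed
  then obtain z where z: "\<And>n. z n \<in> carrier M" "\<And>n. prefix \<omega> (N + n) = x \<diamondop> z n"
    by metis
  obtain \<xi> where \<xi>: "\<xi> \<in> boundary" "\<And>y. y \<in> carrier M \<Longrightarrow> below y \<xi> \<longleftrightarrow> (\<exists>n. y \<preceq> z n)"
  proof (rule supremum_of_traces[of z])
    show "z n \<preceq> z (Suc n)" for n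
    proof -
      have "x \<diamondop> z n \<preceq> x \<diamondop> z (Suc n)"
        unfolding z(2)[symmetric] using assms by (intro prefix_mono) auto
      then show ?thesis using z assms by simp
    qed
    show "\<exists>n. k \<le> trace_length (z n)" for k
    proof -
      have "N + (trace_length x + k) \<le> trace_length x + trace_length (z (trace_length x + k))"
        using length_prefix[OF assms(2), of "N + (trace_length x + k)"] z assms
        by simp
      then show ?thesis by (intro exI[of _ "trace_length x + k"]) simp
    qed
  qed (use z in auto)
  have below_\<xi>: "below y \<xi> \<longleftrightarrow> below (x \<diamondop> y) \<omega>" if y: "y \<in> carrier M" for y
  proof
    assume "below y \<xi>"
    then obtain n where "y \<preceq> z n"
      using \<xi> y by blast
    then have "x \<diamondop> y \<preceq> prefix \<omega> (N + n)"
      using z y assms by simp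
    then show "below (x \<diamondop> y) \<omega>"
      by (auto simp: below_def)
  next
    assume "below (x \<diamondop> y) \<omega>"
    then obtain n where "x \<diamondop> y \<preceq> prefix \<omega> n"
      by (auto simp: below_def)
    also have "prefix \<omega> n \<preceq> x \<diamondop> z n"
      unfolding z(2)[symmetric] using assms by (intro prefix_mono) auto
    finally show "below y \<xi>"
      using z y assms \<xi> by auto
  qed
  have "\<omega> = concat_inf x \<xi>"
  proof (rule boundary_eqI)
    fix y assume y: "y \<in> carrier M"
    show "below y \<omega> \<longleftrightarrow> below y (concat_inf x \<xi>)"
    proof
      assume "below y \<omega>"
      then obtain n where "y \<preceq> prefix \<omega> n"
        by (auto simp: below_def)
      also have "prefix \<omega> n \<preceq> x \<diamondop> z n"
        unfolding z(2)[symmetric] using assms by (intro prefix_mono) auto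
      finally have "y \<preceq> x \<diamondop> z n"
        using y by simp
      moreover have "below (x \<diamondop> z n) (concat_inf x \<xi>)"
        using z \<xi> below_shift[of \<xi> "z n"] trace_le_refl[OF z(1)[of n]] by blast
      ultimately show "below y (concat_inf x \<xi>)"
        using y below_mono[of "x \<diamondop> z n" _ y] by blast
    next
      assume "below y (concat_inf x \<xi>)"
      then obtain n where n: "y \<preceq> x \<diamondop> prefix \<xi> n"
        using below_concat_inf[OF assms(1) \<xi>(1)] y by blast
      have "below (x \<diamondop> prefix \<xi> n) \<omega>"
        using \<xi>(1) below_\<xi>[of "prefix \<xi> n"] below_prefix[OF \<xi>(1), of n] by blast
      then show "below y \<omega>"
        using n y below_mono[of "x \<diamondop> prefix \<xi> n" _ y] by blast
    qed
  qed (use assms \<xi> concat_inf_boundary in auto)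
  moreover have "\<xi>' = \<xi>" if "\<xi>' \<in> boundary" "\<omega> = concat_inf x \<xi>'" for \<xi>'
    using that(1) \<xi>(1)
  proof (rule boundary_eqI)
    fix y assume "y \<in> carrier M"
    then show "below y \<xi>' \<longleftrightarrow> below y \<xi>"
      using below_shift[OF that(1), of y] below_\<xi>[of y] that(2) by simp
  qed
  ultimately have "residual x \<omega> = \<xi>"
    unfolding residual_def using \<xi>(1) by (intro the_equality) auto
  then show "residual x \<omega> \<in> boundary"
    "\<And>y. y \<in> carrier M \<Longrightarrow> below y (residual x \<omega>) \<longleftrightarrow> below (x \<diamondop> y) \<omega>"
    using \<xi> below_\<xi> by auto
qed

section \<open>Borel sets of infinite traces\<close>

lemma countable_carrier: "countable (carrier M)"
  using finite_alphabet by (simp add: carrier_M countable_finite countable_lists)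

lemma topspace_boundary_topology [simp]: "topspace boundary_topology = boundary"
  by (simp add: boundary_topology_def)

lemma open_subsets_boundary: "{U. openin boundary_topology U} \<subseteq> Pow boundary"
  using openin_subset[of boundary_topology] by auto

lemma space_boundary_space [simp]: "space boundary_space = boundary"
  unfolding boundary_space_def by (rule space_measure_of[OF open_subsets_boundary])

lemma sets_boundary_space: "sets boundary_space = sigma_sets boundary {U. openin boundary_topology U}"
  unfolding boundary_space_def
  by (rule sets_measure_of[OF open_subsets_boundary])

lemma openin_boundary_finite_prefix:
  "openin boundary_topology {\<omega> \<in> boundary. P (map \<omega> [0..<n])}"
proof -
  have "openin (product_topology (\<lambda>_::nat. discrete_topology UNIV) UNIV) {\<omega>. P (map \<omega> [0..<n])}"
    unfolding openin_product_topology_alt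
  proof (intro conjI ballI)
    fix \<omega> :: "nat \<Rightarrow> 'a set" assume \<omega>: "\<omega> \<in> {\<omega>. P (map \<omega> [0..<n])}"
    define U where "U i = (if i < n then {\<omega> i} else UNIV)" for i
    have "finite {i. U i \<noteq> UNIV}"
      by (rule finite_subset[of _ "{..<n}"]) (auto simp: U_def)
    moreover have "Pi\<^sub>E UNIV U \<subseteq> {\<omega>. P (map \<omega> [0..<n])}"
    proof
      fix \<omega>' assume "\<omega>' \<in> Pi\<^sub>E UNIV U"
      then have "\<omega>' i \<in> U i" for i by auto
      then have "\<omega>' i = \<omega> i" if "i < n" for i
        using that by (metis U_def singletonD)
      then have "map \<omega>' [0..<n] = map \<omega> [0..<n]" by auto
      then show "\<omega>' \<in> {\<omega>. P (map \<omega> [0..<n])}"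
        using \<omega> by (simp only: mem_Collect_eq)
    qed
    moreover have "\<omega> \<in> Pi\<^sub>E UNIV U"
      by (auto simp: U_def)
    ultimately show "\<exists>U. finite {i \<in> UNIV. U i \<noteq> topspace (discrete_topology UNIV)} \<and>
        (\<forall>i\<in>UNIV. openin (discrete_topology UNIV) (U i)) \<and> \<omega> \<in> Pi\<^sub>E UNIV U \<and>
        Pi\<^sub>E UNIV U \<subseteq> {\<omega>. P (map \<omega> [0..<n])}"
      by (intro exI[of _ U]) auto
  qed
  then have "openin boundary_topology ({\<omega>. P (map \<omega> [0..<n])} \<inter> boundary)"
    unfolding boundary_topology_def openin_subtopology by blast
  then show ?thesis
    by (simp add: Int_def conj_commute)
qed

lemma up_subset: "up x \<subseteq> boundary"
  by (auto simp: up_def)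

lemma up_one [simp]: "up \<epsilon> = boundary"
  by (auto simp: up_def below_def)

lemma sets_up [measurable, simp, intro]: "up x \<in> sets boundary_space"
proof -
  have "openin boundary_topology (\<Union>n. {\<omega> \<in> boundary. x \<preceq> clique_prod (map \<omega> [0..<n])})"
    by (intro openin_Union) (auto intro: openin_boundary_finite_prefix)
  moreover have "(\<Union>n. {\<omega> \<in> boundary. x \<preceq> clique_prod (map \<omega> [0..<n])}) = up x"
    by (auto simp: up_def below_def prefix_def)
  ultimately show ?thesis
    by (auto simp: sets_boundary_space)
qed

text \<open>That \<open>\<omega>\<close> starts with prescribed \<open>n\<close> cliques means that their product \<open>y\<close> is below \<open>\<omega>\<close>, and no
larger trace of height at most \<open>n\<close> is; there are only finitely many of the latter.\<close>

lemma sigma_sets_cylinder: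
  "{\<omega> \<in> boundary. map \<omega> [0..<n] = cs} \<in> sigma_sets boundary (up ` carrier M)" (is "?C \<in> ?S")
proof (cases "?C = {}")
  case False
  then obtain \<omega>0 where \<omega>0: "\<omega>0 \<in> boundary" "map \<omega>0 [0..<n] = cs"
    by blast
  define y where "y = prefix \<omega>0 n"
  have y: "y \<in> traces_of_height n" "y \<in> carrier M"
    using \<omega>0 by (auto simp: y_def prefix_height)
  define H where "H = {z \<in> traces_of_height n. y \<preceq> z \<and> z \<noteq> y}"
  have H: "countable H" "H \<subseteq> carrier M"
    using finite_traces_of_height[of n] traces_of_height_carrier[of n]
    by (auto simp: H_def intro: countable_finite)
  have "map \<omega> [0..<n] = cs \<longleftrightarrow> prefix \<omega> n = y" if "\<omega> \<in> boundary" for \<omega>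
  proof -
    have "normal_form (prefix \<omega> n) (map \<omega> [0..<n])" "normal_form y cs"
      using normal_form_prefix that \<omega>0 by (auto simp: y_def)
    then show ?thesis
      using \<omega>0 that by (metis normal_form_unique normal_form_def)
  qed
  moreover have "prefix \<omega> n = y \<longleftrightarrow> below y \<omega> \<and> (\<forall>z\<in>H. \<not> below z \<omega>)" if \<omega>: "\<omega> \<in> boundary" for \<omega>
  proof -
    have "prefix \<omega> n \<in> traces_of_height n"
      using \<omega> by (rule prefix_height)
    moreover have "z \<in> traces_of_height n \<Longrightarrow> below z \<omega> \<longleftrightarrow> z \<preceq> prefix \<omega> n" for z
      using \<omega> by (rule below_height)
    ultimately show ?thesis
      using y \<omega> trace_le_antisym[of y] H(2) unfolding H_def by auto
  qed
  ultimately have "?C = up y - \<Union>(up ` H)"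
    by (auto simp: up_def)
  also have "\<dots> \<in> ?S"
  proof -
    interpret sigma_algebra boundary ?S
      by (rule sigma_algebra_sigma_sets) (auto simp: up_def)
    have "up z \<in> ?S" if "z \<in> carrier M" for z
      using that by (intro sigma_sets.Basic) auto
    then show ?thesis
      using H y by (intro Diff countable_UN') auto
  qed
  finally show ?thesis .
next
  case True
  show ?thesis unfolding True by (rule sigma_sets.Empty)
qed

text \<open>An open set is the union of the cylinders inside it, and there are only countably many cylinders.\<close>

lemma sets_boundary_space_up: "sets boundary_space = sigma_sets boundary (up ` carrier M)"
proof
  show "sigma_sets boundary (up ` carrier M) \<subseteq> sets boundary_space"
    using sets.sigma_sets_subset[of "up ` carrier M" boundary_space] by auto
  interpret sigma_algebra boundary "sigma_sets boundary (up ` carrier M)"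
    by (rule sigma_algebra_sigma_sets) (auto simp: up_def)
  have "U \<in> sigma_sets boundary (up ` carrier M)" if "openin boundary_topology U" for U
  proof -
    define cyl where "cyl n cs = {\<omega> \<in> boundary. map \<omega> [0..<n] = cs}" for n cs
    define K where "K = {(n, cs). cs \<in> lists (Pow \<Sigma>) \<and> cyl n cs \<subseteq> U}"
    have "countable (lists (Pow \<Sigma>))"
      using finite_alphabet by (intro countable_lists countable_finite) auto
    then have "countable K"
      by (intro countable_subset[of K "UNIV \<times> lists (Pow \<Sigma>)"]) (auto simp: K_def)
    have "U = (\<Union>(n, cs)\<in>K. cyl n cs)"
    proof
      show "U \<subseteq> (\<Union>(n, cs)\<in>K. cyl n cs)"
      proof
        fix \<omega> assume "\<omega> \<in> U"
        have "\<exists>T. openin (product_topology (\<lambda>_. discrete_topology UNIV) UNIV) T \<and> U = T \<inter> boundary"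
          using that by (simp only: boundary_topology_def openin_subtopology)
        then obtain T where T: "openin (product_topology (\<lambda>_. discrete_topology UNIV) UNIV) T" "U = T \<inter> boundary"
          by (elim exE conjE)
        have "\<omega> \<in> T" "\<omega> \<in> boundary"
          using T \<open>\<omega> \<in> U\<close> by auto
        have "\<exists>V. finite {i \<in> UNIV. V i \<noteq> topspace (discrete_topology UNIV)} \<and>
            (\<forall>i\<in>UNIV. openin (discrete_topology UNIV) (V i)) \<and> \<omega> \<in> Pi\<^sub>E UNIV V \<and> Pi\<^sub>E UNIV V \<subseteq> T"
          using T(1)[unfolded openin_product_topology_alt] \<open>\<omega> \<in> T\<close> by (rule bspec)
        then obtain V where V: "finite {i. V i \<noteq> UNIV}" "\<omega> \<in> Pi\<^sub>E UNIV V" "Pi\<^sub>E UNIV V \<subseteq> T"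
          by (elim exE conjE) simp
        obtain n where n: "{i. V i \<noteq> UNIV} \<subseteq> {..<n}"
          using finite_nat_bounded[OF V(1)] by (elim exE)
        have "cyl n (map \<omega> [0..<n]) \<subseteq> U"
        proof
          fix \<omega>' assume \<omega>': "\<omega>' \<in> cyl n (map \<omega> [0..<n])"
          have "\<omega>' i \<in> V i" for i
          proof (cases "i < n")
            case True
            then have "\<omega>' i = \<omega> i"
              using \<omega>' by (auto simp: cyl_def)
            then show ?thesis using V(2) by auto
          next
            case False
            then have "V i = UNIV"
              using n by auto
            then show ?thesis by simp
          qed
          then have "\<omega>' \<in> Pi\<^sub>E UNIV V" by auto
          then show "\<omega>' \<in> U"
            using \<omega>' V T by (auto simp: cyl_def)
        qed
        moreover have "map \<omega> [0..<n] \<in> lists (Pow \<Sigma>)"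
          using \<open>\<omega> \<in> boundary\<close> by (auto simp: boundary_def clique_def in_lists_conv_set)
        ultimately show "\<omega> \<in> (\<Union>(n, cs)\<in>K. cyl n cs)"
          using \<open>\<omega> \<in> boundary\<close> by (auto simp: K_def cyl_def intro!: exI[of _ n])
      qed
    qed (auto simp: K_def)
    also have "\<dots> \<in> sigma_sets boundary (up ` carrier M)"
      using \<open>countable K\<close> by (intro countable_UN'') (auto simp: cyl_def sigma_sets_cylinder)
    finally show ?thesis .
  qed
  then show "sets boundary_space \<subseteq> sigma_sets boundary (up ` carrier M)"
    unfolding sets_boundary_space by (intro sigma_sets_subset) auto
qed

text \<open>An infinite trace above \<open>x\<close> and \<open>y\<close> has a prefix above both, hence above their least common
multiple.\<close>

lemma up_Int:
  assumes "x \<in> carrier M" "y \<in> carrier M"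
  shows "up x \<inter> up y \<in> insert {} (up ` carrier M)"
proof (cases "up x \<inter> up y = {}")
  case False
  then obtain \<omega> where \<omega>: "\<omega> \<in> boundary" "below x \<omega>" "below y \<omega>"
    by (auto simp: up_def)
  obtain n where n: "x \<preceq> prefix \<omega> n" "y \<preceq> prefix \<omega> n"
    using below_common[OF \<omega>(1) assms \<omega>(2,3)] .
  obtain z where z: "z \<in> carrier M" "\<forall>v\<in>carrier M. x \<preceq> v \<and> y \<preceq> v \<longleftrightarrow> z \<preceq> v"
    using lcm_exists[OF assms prefix_carrier[OF \<omega>(1)] n] by blast
  have "below x \<xi> \<and> below y \<xi> \<longleftrightarrow> below z \<xi>" if \<xi>: "\<xi> \<in> boundary" for \<xi>
  proof
    assume "below x \<xi> \<and> below y \<xi>"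
    then obtain m where "x \<preceq> prefix \<xi> m" "y \<preceq> prefix \<xi> m"
      using below_common[OF \<xi> assms] by blast
    then show "below z \<xi>"
      using z \<xi> unfolding below_def by blast
  next
    assume "below z \<xi>"
    then show "below x \<xi> \<and> below y \<xi>"
      using z \<xi> unfolding below_def by blast
  qed
  then have "up x \<inter> up y = up z"
    by (auto simp: up_def)
  with z show ?thesis by blast
qed simp

lemma measure_eqI_up:
  assumes "sets N = sets boundary_space" "sets N' = sets boundary_space"
    and "\<And>x. x \<in> carrier M \<Longrightarrow> emeasure N (up x) = emeasure N' (up x)"
    and "emeasure N boundary \<noteq> \<infinity>"
  shows "N = N'"
proof (rule measure_eqI_generator_eq[where E = "insert {} (up ` carrier M)" and \<Omega> = boundary and A = "\<lambda>_. boundary"])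
  show "Int_stable (insert {} (up ` carrier M))"
    unfolding Int_stable_def
  proof (intro ballI)
    fix A B assume AB: "A \<in> insert {} (up ` carrier M)" "B \<in> insert {} (up ` carrier M)"
    show "A \<inter> B \<in> insert {} (up ` carrier M)"
    proof (cases "A = {} \<or> B = {}")
      case False
      then obtain x y where "x \<in> carrier M" "y \<in> carrier M" "A = up x" "B = up y"
        using AB by blast
      with up_Int[of x y] show ?thesis by auto
    qed auto
  qed
  have "sigma_sets boundary (insert {} (up ` carrier M)) = sigma_sets boundary (up ` carrier M)"
    by (rule sigma_sets_eqI) (auto intro: sigma_sets.intros)
  then show "sets N = sigma_sets boundary (insert {} (up ` carrier M))"
    "sets N' = sigma_sets boundary (insert {} (up ` carrier M))"
    using assms sets_boundary_space_up by auto
  show "range (\<lambda>_::nat. boundary) \<subseteq> insert {} (up ` carrier M)"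
    using up_one one_carrier by blast
  show "insert {} (up ` carrier M) \<subseteq> Pow boundary"
    by (auto simp: up_def)
qed (use assms in auto)

lemma residual_up_iff:
  assumes "x \<in> carrier M" "y \<in> carrier M"
  shows "\<omega> \<in> up x \<and> residual x \<omega> \<in> up y \<longleftrightarrow> \<omega> \<in> up (x \<diamondop> y)"
proof -
  have "below x \<omega>" if "below (x \<diamondop> y) \<omega>"
    using below_mono[OF that] assms by simp
  then show ?thesis
    using assms below_residual[of x \<omega> y] residual_boundary[of x \<omega>] by (auto simp: up_def)
qed

lemma measurable_residual [measurable]:
  assumes "x \<in> carrier M"
  shows "residual x \<in> measurable (restrict_space boundary_space (up x)) boundary_space"
proof (rule measurable_sigma_sets[OF sets_boundary_space_up])
  show "residual x \<in> space (restrict_space boundary_space (up x)) \<rightarrow> boundary"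
    using assms residual_boundary by (auto simp: space_restrict_space up_def)
  fix A assume "A \<in> up ` carrier M"
  then obtain y where y: "y \<in> carrier M" "A = up y" by auto
  have "residual x -` A \<inter> space (restrict_space boundary_space (up x)) = up x \<inter> up (x \<diamondop> y)"
    using residual_up_iff[OF assms y(1)] y up_subset[of x] by (auto simp: space_restrict_space)
  also have "\<dots> \<in> sets (restrict_space boundary_space (up x))"
    by (auto simp: sets_restrict_space)
  finally show "residual x -` A \<inter> space (restrict_space boundary_space (up x)) \<in> sets (restrict_space boundary_space (up x))" .
qed (auto simp: up_def)

section \<open>Recurrent and avoided letters\<close>

lemma disjoint_up_first_passage: "disjoint_family_on up (first_passage c)"
  unfolding disjoint_family_on_def
proof (intro ballI impI)
  fix x y assume xy: "x \<in> first_passage c" "y \<in> first_passage c" "x \<noteq> y"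
  then have carrier: "x \<in> carrier M" "y \<in> carrier M"
    by (auto simp: first_passage_def)
  have False if \<omega>: "\<omega> \<in> boundary" "below x \<omega>" "below y \<omega>" for \<omega>
  proof -
    obtain n where "x \<preceq> prefix \<omega> n" "y \<preceq> prefix \<omega> n"
      using below_common[OF \<omega>(1) carrier \<omega>(2,3)] .
    then show False
      using first_passage_unique[OF xy(1,2)] \<omega>(1) xy(3) by blast
  qed
  then show "up x \<inter> up y = {}"
    by (auto simp: up_def)
qed

lemma up_Int_boundary [simp]: "up x \<inter> boundary = up x"
  using up_subset by blast

lemma countable_first_passage: "countable (first_passage c)"
  using countable_carrier by (rule countable_subset[rotated]) (auto simp: first_passage_def)

text \<open>Occurrences are counted in the finite traces below \<open>\<omega>\<close> rather than in its cliques, so that passing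
to residuals needs only \<open>below_residual\<close>.\<close>

definition recurs :: "'a \<Rightarrow> (nat \<Rightarrow> 'a set) \<Rightarrow> bool" where
  "recurs c \<omega> \<longleftrightarrow> (\<forall>n. \<exists>y\<in>carrier M. n \<le> occurrences c y \<and> below y \<omega>)"

lemma recurs_first_passage:
  assumes "\<omega> \<in> boundary" "recurs c \<omega>"
  shows "\<exists>v\<in>first_passage c. \<omega> \<in> up v"
proof -
  obtain y where y: "y \<in> carrier M" "1 \<le> occurrences c y" "below y \<omega>"
    using assms(2) by (auto simp: recurs_def)
  then obtain v where v: "v \<in> first_passage c" "v \<preceq> y"
    using first_passage_exists[of y c] by auto
  then have "\<omega> \<in> up v"
    using assms(1) below_mono[OF y(3)] by (auto simp: up_def first_passage_def)
  with v show ?thesis by blast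
qed

definition avoids :: "'a \<Rightarrow> (nat \<Rightarrow> 'a set) \<Rightarrow> bool" where
  "avoids d \<omega> \<longleftrightarrow> (\<forall>y\<in>carrier M. below y \<omega> \<longrightarrow> occurrences d y = 0)"

lemma sets_recurs_avoids [measurable]:
  "{\<omega> \<in> boundary. recurs c \<omega> \<and> avoids d \<omega>} \<in> sets boundary_space"
proof -
  have "{\<omega> \<in> boundary. recurs c \<omega> \<and> avoids d \<omega>} =
      (\<Inter>n. \<Union>y\<in>{y \<in> carrier M. n \<le> occurrences c y}. up y) -
      (\<Union>y\<in>{y \<in> carrier M. 0 < occurrences d y}. up y)"
    by (auto simp: recurs_def avoids_def up_def)
  also have "\<dots> \<in> sets boundary_space"
    using countable_carrier
    by (intro sets.Diff sets.countable_INT sets.countable_UN') (auto intro: countable_subset)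
  finally show ?thesis .
qed

lemma below_residualE:
  assumes "x \<in> carrier M" "\<omega> \<in> boundary" "below x \<omega>" "y \<in> carrier M" "below y \<omega>"
  obtains z where "z \<in> carrier M" "y \<preceq> x \<diamondop> z" "below z (residual x \<omega>)"
proof -
  obtain n where n: "x \<preceq> prefix \<omega> n" "y \<preceq> prefix \<omega> n"
    using below_common[OF assms(2,1,4,3,5)] .
  obtain z where z: "z \<in> carrier M" "prefix \<omega> n = x \<diamondop> z"
    using n(1) by (auto elim: trace_leE)
  have "below (x \<diamondop> z) \<omega>"
    using below_prefix[OF assms(2), of n] z by simp
  then have "below z (residual x \<omega>)"
    using below_residual[OF assms(1-3) z(1)] by simp
  with that z n show thesis by simp
qed

lemma recurs_residual:
  assumes "x \<in> carrier M" "\<omega> \<in> boundary" "below x \<omega>"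
  shows "recurs c (residual x \<omega>) \<longleftrightarrow> recurs c \<omega>"
proof
  assume *: "recurs c (residual x \<omega>)"
  show "recurs c \<omega>"
    unfolding recurs_def
  proof
    fix n
    obtain y where y: "y \<in> carrier M" "n \<le> occurrences c y" "below y (residual x \<omega>)"
      using * unfolding recurs_def by blast
    then have "below (x \<diamondop> y) \<omega>"
      using below_residual[OF assms y(1)] by simp
    then show "\<exists>y\<in>carrier M. n \<le> occurrences c y \<and> below y \<omega>"
      using y assms by (intro bexI[of _ "x \<diamondop> y"]) auto
  qed
next
  assume *: "recurs c \<omega>"
  show "recurs c (residual x \<omega>)"
    unfolding recurs_def
  proof
    fix n
    obtain y where y: "y \<in> carrier M" "n + occurrences c x \<le> occurrences c y" "below y \<omega>"
      using * unfolding recurs_def by blast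
    obtain z where z: "z \<in> carrier M" "y \<preceq> x \<diamondop> z" "below z (residual x \<omega>)"
      using below_residualE[OF assms y(1,3)] .
    have "n \<le> occurrences c z"
      using occurrences_mono[OF z(2) y(1), of c] y assms z by simp
    with z show "\<exists>y\<in>carrier M. n \<le> occurrences c y \<and> below y (residual x \<omega>)"
      by blast
  qed
qed

lemma avoids_residual:
  assumes "x \<in> carrier M" "\<omega> \<in> boundary" "below x \<omega>"
  shows "avoids d \<omega> \<longleftrightarrow> occurrences d x = 0 \<and> avoids d (residual x \<omega>)"
proof
  assume *: "avoids d \<omega>"
  then show "occurrences d x = 0 \<and> avoids d (residual x \<omega>)"
    using assms below_residual[OF assms] unfolding avoids_def by fastforce
next
  assume *: "occurrences d x = 0 \<and> avoids d (residual x \<omega>)"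
  show "avoids d \<omega>"
    unfolding avoids_def
  proof (intro ballI impI)
    fix y assume y: "y \<in> carrier M" "below y \<omega>"
    obtain z where z: "z \<in> carrier M" "y \<preceq> x \<diamondop> z" "below z (residual x \<omega>)"
      using below_residualE[OF assms y] .
    then have "occurrences d z = 0"
      using * by (auto simp: avoids_def)
    then show "occurrences d y = 0"
      using occurrences_mono[OF z(2) y(1), of d] * assms z by simp
  qed
qed

text \<open>Dependence is connected, so along a path from a recurrent letter to \<open>a\<close> there is an edge from a
recurrent letter \<open>c\<close> to a letter \<open>d\<close> that does not recur.\<close>

lemma recurs_or_eventually_avoids:
  assumes irr: "irreducible_monoid" and \<omega>: "\<omega> \<in> boundary" and a: "a \<in> \<Sigma>" "\<not> recurs a \<omega>"
  obtains x c d where "x \<in> carrier M" "below x \<omega>" "c \<in> \<Sigma>" "d \<in> \<Sigma>" "(c, d) \<notin> I"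
    "recurs c (residual x \<omega>)" "avoids d (residual x \<omega>)"
proof -
  have bounded: "\<exists>N. \<forall>n. occurrences d (prefix \<omega> n) < N" if "\<not> recurs d \<omega>" for d
    using that below_prefix[OF \<omega>] prefix_carrier[OF \<omega>] unfolding recurs_def by (meson not_le)
  have "\<exists>c\<in>\<Sigma>. recurs c \<omega>"
  proof (rule ccontr)
    assume "\<not> (\<exists>c\<in>\<Sigma>. recurs c \<omega>)"
    then have "\<forall>c\<in>\<Sigma>. \<exists>N. \<forall>n. occurrences c (prefix \<omega> n) < N"
      using bounded by blast
    then obtain N where N: "\<And>c n. c \<in> \<Sigma> \<Longrightarrow> occurrences c (prefix \<omega> n) < N c"
      by metis
    have "trace_length (prefix \<omega> n) \<le> (\<Sum>c\<in>\<Sigma>. N c)" for n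
      unfolding trace_length_def using N by (intro sum_mono) (auto intro: less_imp_le)
    from this[of "Suc (\<Sum>c\<in>\<Sigma>. N c)"] show False
      using length_prefix[OF \<omega>, of "Suc (\<Sum>c\<in>\<Sigma>. N c)"] by simp
  qed
  then obtain c0 where c0: "c0 \<in> \<Sigma>" "recurs c0 \<omega>" ..
  then have "(c0, a) \<in> ((\<Sigma> \<times> \<Sigma>) - I)\<^sup>*"
    using irr a by (auto simp: irreducible_monoid_def)
  then have "\<exists>c d. c \<in> \<Sigma> \<and> d \<in> \<Sigma> \<and> (c, d) \<notin> I \<and> recurs c \<omega> \<and> \<not> recurs d \<omega>"
    using a(2) c0(2) by (induction rule: rtrancl_induct) auto
  then obtain c d where cd: "c \<in> \<Sigma>" "d \<in> \<Sigma>" "(c, d) \<notin> I" "recurs c \<omega>" "\<not> recurs d \<omega>"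
    by blast
  obtain N where N: "\<And>n. occurrences d (prefix \<omega> n) < N"
    using bounded[OF cd(5)] by blast
  obtain k where k: "\<And>n. occurrences d (prefix \<omega> n) \<le> occurrences d (prefix \<omega> k)"
    using ex_has_greatest_nat[of "\<lambda>_. True" 0 "\<lambda>n. occurrences d (prefix \<omega> n)" N] N by (auto intro: less_imp_le)
  \<comment> \<open>All occurrences of \<open>d\<close> in \<open>\<omega>\<close> lie in this prefix.\<close>
  define x where "x = prefix \<omega> k"
  have x: "x \<in> carrier M" "below x \<omega>"
    using \<omega> by (auto simp: x_def)
  have "avoids d (residual x \<omega>)"
    unfolding avoids_def
  proof (intro ballI impI)
    fix y assume y: "y \<in> carrier M" "below y (residual x \<omega>)"
    then have "below (x \<diamondop> y) \<omega>"
      using below_residual[OF x(1) \<omega> x(2) y(1)] by simp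
    then obtain n where n: "x \<diamondop> y \<preceq> prefix \<omega> n"
      by (auto simp: below_def)
    then have "occurrences d x + occurrences d y \<le> occurrences d (prefix \<omega> n)"
      using occurrences_mono[OF n, of d] x y by simp
    then show "occurrences d y = 0"
      using k[of n] by (simp add: x_def)
  qed
  with x cd show thesis
    using recurs_residual[OF x(1) \<omega> x(2)] by (intro that) auto
qed

end

section \<open>The maximum principle\<close>

text \<open>The total integral \<open>m\<close> of \<open>f\<close> is its mean, and the mean of \<open>f\<close> over each of the disjoint sets is at
most \<open>m\<close>. A strict inequality on one of them would make the total smaller than \<open>m\<close>. The sets need
not cover the space: outside of them \<open>f\<close> vanishes.\<close>

lemma (in prob_space) nn_integral_max_principle:
  fixes f :: "'a \<Rightarrow> ennreal" and A :: "'i \<Rightarrow> 'a set" and m :: ennreal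
  assumes f [measurable]: "f \<in> borel_measurable M"
    and V: "countable V" "disjoint_family_on A V" "\<And>v. v \<in> V \<Longrightarrow> A v \<in> events"
    and le: "\<And>v. v \<in> V \<Longrightarrow> (\<integral>\<^sup>+\<omega>\<in>A v. f \<omega> \<partial>M) \<le> m * emeasure M (A v)"
    and zero: "AE \<omega> in M. \<omega> \<notin> \<Union>(A ` V) \<longrightarrow> f \<omega> = 0"
    and total: "(\<integral>\<^sup>+\<omega>. f \<omega> \<partial>M) = m" "m < \<infinity>"
    and v: "v \<in> V"
  shows "(\<integral>\<^sup>+\<omega>\<in>A v. f \<omega> \<partial>M) = m * emeasure M (A v)"
proof (rule ccontr)
  define D where "D = density M f"
  define R where "R = \<Union>(A ` (V - {v}))"
  have D: "emeasure D B = (\<integral>\<^sup>+\<omega>\<in>B. f \<omega> \<partial>M)" if "B \<in> events" for B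
    using that by (simp add: D_def emeasure_density)
  have A: "A v \<in> events" "R \<in> events" "A v \<inter> R = {}" "A v \<union> R = \<Union>(A ` V)"
    using V v unfolding R_def by (auto simp: disjoint_family_on_def intro: sets.countable_UN')
  have sets_D: "sets D = events"
    by (simp add: D_def)
  have "emeasure D R = (\<integral>\<^sup>+i. emeasure D (A i) \<partial>count_space (V - {v}))"
    unfolding R_def using V sets_D
    by (intro emeasure_UN_countable) (auto simp: disjoint_family_on_def)
  also have "\<dots> \<le> (\<integral>\<^sup>+i. emeasure (scale_measure m M) (A i) \<partial>count_space (V - {v}))"
    using D V(3) le by (intro nn_integral_mono) auto
  also have "\<dots> = emeasure (scale_measure m M) R"
    unfolding R_def using V
    by (intro emeasure_UN_countable[symmetric]) (auto simp: disjoint_family_on_def)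
  finally have DR: "emeasure D R \<le> m * emeasure M R"
    by simp
  have finite: "m * emeasure M R < \<infinity>"
    using total(2) by (simp add: ennreal_mult_less_top emeasure_eq_measure)
  have "m = (\<integral>\<^sup>+\<omega>\<in>A v \<union> R. f \<omega> \<partial>M)"
    unfolding total(1)[symmetric] using zero A(4)
    by (intro nn_integral_cong_AE) (auto split: split_indicator)
  also have "\<dots> = emeasure D (A v \<union> R)"
    using A(1,2) by (intro D[symmetric] sets.Un)
  also have "\<dots> = emeasure D (A v) + emeasure D R"
    using A sets_D by (intro plus_emeasure[symmetric]) auto
  also have "\<dots> \<le> emeasure D (A v) + m * emeasure M R"
    using DR by (rule add_left_mono)
  finally have m_le: "m \<le> m * emeasure M R + emeasure D (A v)"
    by (simp add: add.commute)
  assume "(\<integral>\<^sup>+\<omega>\<in>A v. f \<omega> \<partial>M) \<noteq> m * emeasure M (A v)"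
  then have "emeasure D (A v) < m * emeasure M (A v)"
    using le[OF v] D[OF A(1)] by simp
  then have "m * emeasure M R + emeasure D (A v) < m * emeasure M R + m * emeasure M (A v)"
    using finite by (simp add: ennreal_add_left_cancel_less)
  also have "\<dots> = m * emeasure M (A v \<union> R)"
    using A by (subst plus_emeasure[symmetric]) (auto simp: algebra_simps)
  also have "\<dots> \<le> m * 1"
    by (intro mult_left_mono emeasure_le_1) auto
  finally show False
    using m_le by simp
qed

section \<open>Markov measures on irreducible systems\<close>

locale irreducible_markov_system = concurrent_system \<Sigma> I X act
  for \<Sigma> :: "'a set" and I :: "('a \<times> 'a) set"
    and X :: "'s set" and act :: "'s option \<Rightarrow> 'a list set \<Rightarrow> 's option" +
  fixes \<nu> :: "'s \<Rightarrow> (nat \<Rightarrow> 'a set) measure"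
  assumes irreducible: irreducible_system and markov: "markov_measure \<nu>"
begin

abbreviation target :: "'s \<Rightarrow> 'a list set \<Rightarrow> 's" where
  "target \<alpha> x \<equiv> the (act (Some \<alpha>) x)"

lemma traces_from_carrier: "x \<in> traces_from \<alpha> \<Longrightarrow> x \<in> carrier M"
  by (simp add: traces_from_def)

lemma act_target: "x \<in> traces_from \<alpha> \<Longrightarrow> act (Some \<alpha>) x = Some (target \<alpha> x)"
  by (auto simp: traces_from_def)

lemma target_state: "\<alpha> \<in> X \<Longrightarrow> x \<in> traces_from \<alpha> \<Longrightarrow> target \<alpha> x \<in> X"
  using act_closed[of "Some \<alpha>" x] by (auto simp: traces_from_def)

lemma act_Some_mult:
  "\<alpha> \<in> X \<Longrightarrow> x \<in> carrier M \<Longrightarrow> y \<in> carrier M \<Longrightarrow> act (Some \<alpha>) (x \<diamondop> y) = act (act (Some \<alpha>) x) y"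
  by (simp add: act_mult)

lemma mult_traces_from_iff:
  assumes "\<alpha> \<in> X" "x \<in> carrier M" "y \<in> carrier M"
  shows "x \<diamondop> y \<in> traces_from \<alpha> \<longleftrightarrow> x \<in> traces_from \<alpha> \<and> y \<in> traces_from (target \<alpha> x)"
  using assms act_bot[of y] by (cases "act (Some \<alpha>) x") (auto simp: traces_from_def act_Some_mult)

lemma target_mult:
  assumes "\<alpha> \<in> X" "x \<in> traces_from \<alpha>" "y \<in> carrier M"
  shows "target \<alpha> (x \<diamondop> y) = target (target \<alpha> x) y"
  using assms by (auto simp: traces_from_def act_Some_mult)

lemma prob_space_\<nu>: "\<alpha> \<in> X \<Longrightarrow> prob_space (\<nu> \<alpha>)"
  using markov by (simp add: markov_measure_def)

lemma sets_\<nu>: "\<alpha> \<in> X \<Longrightarrow> sets (\<nu> \<alpha>) = sets boundary_space"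
  using markov by (simp add: markov_measure_def)

lemma space_\<nu>: "\<alpha> \<in> X \<Longrightarrow> space (\<nu> \<alpha>) = boundary"
  using sets_eq_imp_space_eq[OF sets_\<nu>] by simp

lemma emeasure_\<nu>: "\<alpha> \<in> X \<Longrightarrow> emeasure (\<nu> \<alpha>) A = ennreal (measure (\<nu> \<alpha>) A)"
  using prob_space_\<nu> by (simp add: finite_measure.emeasure_eq_measure prob_space_def)

lemma up_pos:
  assumes "\<alpha> \<in> X" "x \<in> traces_from \<alpha>"
  shows "0 < emeasure (\<nu> \<alpha>) (up x)"
  using assms markov traces_from_carrier[OF assms(2)]
  by (simp add: markov_measure_def emeasure_\<nu>)

lemma up_null:
  assumes "\<alpha> \<in> X" "x \<in> carrier M" "x \<notin> traces_from \<alpha>"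
  shows "emeasure (\<nu> \<alpha>) (up x) = 0"
proof -
  have "\<not> 0 < measure (\<nu> \<alpha>) (up x)"
    using assms markov unfolding markov_measure_def by blast
  then show ?thesis
    using assms by (simp add: emeasure_\<nu> not_less ennreal_neg)
qed

lemma emeasure_up_mult:
  assumes "\<alpha> \<in> X" "x \<in> traces_from \<alpha>" "y \<in> carrier M"
  shows "emeasure (\<nu> \<alpha>) (up (x \<diamondop> y)) = emeasure (\<nu> \<alpha>) (up x) * emeasure (\<nu> (target \<alpha> x)) (up y)"
proof -
  have "measure (\<nu> \<alpha>) (up (x \<diamondop> y)) = (case act (Some \<alpha>) x of None \<Rightarrow> 0
      | Some \<beta> \<Rightarrow> measure (\<nu> \<alpha>) (up x) * measure (\<nu> \<beta>) (up y))"
    using assms markov traces_from_carrier[OF assms(2)] unfolding markov_measure_def by blast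
  moreover obtain \<beta> where "act (Some \<alpha>) x = Some \<beta>"
    using act_target[OF assms(2)] by blast
  ultimately show ?thesis
    using assms target_state[OF assms(1,2)] by (simp add: emeasure_\<nu> ennreal_mult)
qed

lemma measurable_residual_\<nu>:
  assumes "\<alpha> \<in> X" "x \<in> carrier M"
  shows "residual x \<in> measurable (restrict_space (\<nu> \<alpha>) (up x)) boundary_space"
  using measurable_residual[OF assms(2)] sets_\<nu>[OF assms(1)]
  by (simp add: measurable_cong_sets[OF sets_restrict_space_cong[OF sets_\<nu>[OF assms(1)]] HOL.refl])

text \<open>The strong form of the Markov property: both measures give \<open>\<up>y\<close> the mass of \<open>\<up>(xy)\<close>.\<close>

lemma distr_residual:
  assumes "\<alpha> \<in> X" "x \<in> traces_from \<alpha>"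
  shows "distr (restrict_space (\<nu> \<alpha>) (up x)) boundary_space (residual x) =
    scale_measure (emeasure (\<nu> \<alpha>) (up x)) (\<nu> (target \<alpha> x))" (is "?L = ?R")
proof (rule measure_eqI_up)
  have x: "x \<in> carrier M" "target \<alpha> x \<in> X"
    using assms traces_from_carrier target_state by auto
  have emeasure: "emeasure ?L (up y) = emeasure (\<nu> \<alpha>) (up (x \<diamondop> y))" if y: "y \<in> carrier M" for y
  proof -
    have "emeasure ?L (up y) =
        emeasure (restrict_space (\<nu> \<alpha>) (up x)) (residual x -` up y \<inter> space (restrict_space (\<nu> \<alpha>) (up x)))"
      using measurable_residual_\<nu> assms x by (intro emeasure_distr) auto
    also have "residual x -` up y \<inter> space (restrict_space (\<nu> \<alpha>) (up x)) = up (x \<diamondop> y)"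
      using residual_up_iff[OF x(1) y] up_subset[of x] assms by (auto simp: space_restrict_space space_\<nu>)
    also have "emeasure (restrict_space (\<nu> \<alpha>) (up x)) (up (x \<diamondop> y)) = emeasure (\<nu> \<alpha>) (up (x \<diamondop> y))"
      using assms residual_up_iff[OF x(1) y] by (intro emeasure_restrict_space) (auto simp: sets_\<nu> space_\<nu>)
    finally show ?thesis .
  qed
  then show "emeasure ?L (up y) = emeasure ?R (up y)" if "y \<in> carrier M" for y
    using that assms by (simp add: emeasure_up_mult)
  show "emeasure ?L boundary \<noteq> \<infinity>"
    using emeasure[OF one_carrier] assms x by (simp add: emeasure_\<nu>)
qed (use assms sets_\<nu> target_state in auto)

lemma nn_integral_residual:
  assumes "\<alpha> \<in> X" "x \<in> traces_from \<alpha>" "f \<in> borel_measurable boundary_space"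
  shows "(\<integral>\<^sup>+\<omega>\<in>up x. f (residual x \<omega>) \<partial>\<nu> \<alpha>) = emeasure (\<nu> \<alpha>) (up x) * (\<integral>\<^sup>+\<omega>. f \<omega> \<partial>\<nu> (target \<alpha> x))"
proof -
  have x: "x \<in> carrier M" "target \<alpha> x \<in> X"
    using assms traces_from_carrier target_state by auto
  have "(\<integral>\<^sup>+\<omega>\<in>up x. f (residual x \<omega>) \<partial>\<nu> \<alpha>) =
      (\<integral>\<^sup>+\<omega>. f (residual x \<omega>) \<partial>restrict_space (\<nu> \<alpha>) (up x))"
    using assms by (intro nn_integral_restrict_space[symmetric]) (auto simp: sets_\<nu> space_\<nu>)
  also have "\<dots> = (\<integral>\<^sup>+\<omega>. f \<omega> \<partial>distr (restrict_space (\<nu> \<alpha>) (up x)) boundary_space (residual x))"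
    using measurable_residual_\<nu>[OF assms(1) x(1)] assms(3)
    by (intro nn_integral_distr[symmetric]) simp_all
  also have "\<dots> = emeasure (\<nu> \<alpha>) (up x) * (\<integral>\<^sup>+\<omega>. f \<omega> \<partial>\<nu> (target \<alpha> x))"
    using assms x by (simp add: distr_residual nn_integral_scale_measure measurable_cong_sets[OF sets_\<nu> HOL.refl])
  finally show ?thesis .
qed

lemma nn_integral_up_outside:
  assumes "\<alpha> \<in> X" "x \<in> carrier M" "x \<notin> traces_from \<alpha>"
  shows "(\<integral>\<^sup>+\<omega>\<in>up x. f \<omega> \<partial>\<nu> \<alpha>) = 0"
proof -
  have "AE \<omega> in \<nu> \<alpha>. \<omega> \<notin> up x"
    using assms by (intro AE_not_in null_setsI up_null) (auto simp: sets_\<nu>)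
  then have "(\<integral>\<^sup>+\<omega>\<in>up x. f \<omega> \<partial>\<nu> \<alpha>) = (\<integral>\<^sup>+\<omega>. 0 \<partial>\<nu> \<alpha>)"
    by (intro nn_integral_cong_AE) (auto elim!: eventually_mono)
  then show ?thesis by simp
qed

text \<open>If the mean \<open>m\<close> of \<open>f\<close> dominates its conditional means \<open>k v\<close> given the first passages \<open>v\<close> of \<open>c\<close>,
all these conditional means equal \<open>m\<close>. Below, \<open>f\<close> is a member of a shift-invariant family and \<open>k v\<close> is
the mean of its member at the state reached by \<open>v\<close>.\<close>

lemma first_passage_max_principle:
  fixes f :: "(nat \<Rightarrow> 'a set) \<Rightarrow> ennreal" and k :: "'a list set \<Rightarrow> ennreal"
  assumes \<alpha>: "\<alpha> \<in> X" and f: "f \<in> borel_measurable boundary_space"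
    and m: "(\<integral>\<^sup>+\<omega>. f \<omega> \<partial>\<nu> \<alpha>) = m" "m < \<infinity>"
    and zero: "AE \<omega> in \<nu> \<alpha>. \<not> recurs c \<omega> \<longrightarrow> f \<omega> = 0"
    and k: "\<And>v. v \<in> first_passage c \<Longrightarrow> v \<in> traces_from \<alpha> \<Longrightarrow>
        (\<integral>\<^sup>+\<omega>\<in>up v. f \<omega> \<partial>\<nu> \<alpha>) = k v * emeasure (\<nu> \<alpha>) (up v)"
      "\<And>v. v \<in> first_passage c \<Longrightarrow> v \<in> traces_from \<alpha> \<Longrightarrow> k v \<le> m"
    and v: "v \<in> first_passage c" "v \<in> traces_from \<alpha>"
  shows "k v = m"
proof -
  interpret prob_space "\<nu> \<alpha>"
    using \<alpha> by (rule prob_space_\<nu>)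
  have "(\<integral>\<^sup>+\<omega>\<in>up v. f \<omega> \<partial>\<nu> \<alpha>) = m * emeasure (\<nu> \<alpha>) (up v)"
  proof (rule nn_integral_max_principle[where A = up and V = "first_passage c"])
    show "f \<in> borel_measurable (\<nu> \<alpha>)"
      using f \<alpha> by (simp add: measurable_cong_sets[OF sets_\<nu> HOL.refl])
    show "(\<integral>\<^sup>+\<omega>\<in>up w. f \<omega> \<partial>\<nu> \<alpha>) \<le> m * emeasure (\<nu> \<alpha>) (up w)" if w: "w \<in> first_passage c" for w
    proof (cases "w \<in> traces_from \<alpha>")
      case True
      then show ?thesis
        using k w by (simp add: mult_right_mono)
    next
      case False
      then show ?thesis
        using nn_integral_up_outside[OF \<alpha>] w by (simp add: first_passage_def)
    qed
    show "AE \<omega> in \<nu> \<alpha>. \<omega> \<notin> \<Union>(up ` first_passage c) \<longrightarrow> f \<omega> = 0"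
      using zero AE_space
    proof eventually_elim
      case (elim \<omega>)
      then show ?case
        using recurs_first_passage[of \<omega> c] \<alpha> by (auto simp: space_\<nu>)
    qed
  qed (use \<alpha> m v countable_first_passage disjoint_up_first_passage in \<open>auto simp: sets_\<nu>\<close>)
  then have "emeasure (\<nu> \<alpha>) (up v) * k v = emeasure (\<nu> \<alpha>) (up v) * m"
    using k(1)[OF v] by (simp add: mult.commute)
  then show ?thesis
    using up_pos[OF \<alpha> v(2)] by (auto simp: ennreal_mult_cancel_left)
qed

text \<open>Let \<open>m\<close> be the largest probability of this event over all states. For \<open>x \<le> \<omega>\<close> its indicator at \<open>\<omega>\<close> is that at
\<open>x\<^sup>-\<^sup>1\<omega>\<close> if \<open>x\<close> is free of \<open>d\<close>, and \<open>0\<close> otherwise. So if \<open>m\<close> is not zero, the maximum principle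
forbids \<open>d\<close> in the enabled first passages of \<open>c\<close> at a maximal state.\<close>

lemma recurs_avoids_null:
  assumes cd: "c \<in> \<Sigma>" "d \<in> \<Sigma>" "(c, d) \<notin> I" and \<alpha>: "\<alpha> \<in> X"
  shows "emeasure (\<nu> \<alpha>) {\<omega> \<in> boundary. recurs c \<omega> \<and> avoids d \<omega>} = 0"
proof -
  define G where "G = {\<omega> \<in> boundary. recurs c \<omega> \<and> avoids d \<omega>}"
  have G [measurable]: "G \<in> sets boundary_space"
    unfolding G_def by measurable
  define g where "g \<beta> = emeasure (\<nu> \<beta>) G" for \<beta>
  define m where "m = Max (g ` X)"
  have g_le: "g \<beta> \<le> m" if "\<beta> \<in> X" for \<beta>
    using that finite_states by (simp add: m_def)
  have "m \<in> g ` X"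
    unfolding m_def using finite_states \<alpha> by (intro Max_in) auto
  then obtain \<alpha>0 where \<alpha>0: "\<alpha>0 \<in> X" "g \<alpha>0 = m" by auto
  have G_residual: "(\<integral>\<^sup>+\<omega>\<in>up x. indicator G \<omega> \<partial>\<nu> \<beta>) =
      (if occurrences d x = 0 then emeasure (\<nu> \<beta>) (up x) * g (target \<beta> x) else 0)"
    if "\<beta> \<in> X" "x \<in> traces_from \<beta>" for \<beta> x
  proof -
    have x: "x \<in> carrier M" "target \<beta> x \<in> X"
      using that traces_from_carrier target_state by auto
    have "(\<integral>\<^sup>+\<omega>\<in>up x. indicator G \<omega> \<partial>\<nu> \<beta>) =
        (\<integral>\<^sup>+\<omega>\<in>up x. (if occurrences d x = 0 then indicator G (residual x \<omega>) else 0) \<partial>\<nu> \<beta>)"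
      using recurs_residual[OF x(1)] avoids_residual[OF x(1)] residual_boundary[OF x(1)]
      by (intro nn_integral_cong) (auto simp: G_def up_def split: split_indicator)
    also have "\<dots> = (if occurrences d x = 0 then emeasure (\<nu> \<beta>) (up x) * g (target \<beta> x) else 0)"
      using that x by (simp add: nn_integral_residual sets_\<nu> g_def)
    finally show ?thesis .
  qed
  show ?thesis
  proof (rule ccontr)
    assume "emeasure (\<nu> \<alpha>) {\<omega> \<in> boundary. recurs c \<omega> \<and> avoids d \<omega>} \<noteq> 0"
    then have "m \<noteq> 0"
      using g_le[OF \<alpha>] by (auto simp: g_def G_def)
    have "m < \<infinity>"
      using \<alpha>0 by (auto simp: g_def emeasure_\<nu>)
    have step: "occurrences d v = 0 \<and> g (target \<beta> v) = m"
      if \<beta>: "\<beta> \<in> X" "g \<beta> = m" and v: "v \<in> first_passage c" "v \<in> traces_from \<beta>" for \<beta> v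
    proof -
      let ?k = "\<lambda>v. if occurrences d v = 0 then g (target \<beta> v) else 0"
      have "?k v = m"
      proof (rule first_passage_max_principle[where k = ?k, OF \<beta>(1) _ _ \<open>m < \<infinity>\<close> _ _ _ v])
        show "(\<integral>\<^sup>+\<omega>. indicator G \<omega> \<partial>\<nu> \<beta>) = m"
          using \<beta> by (simp add: g_def sets_\<nu>)
        show "AE \<omega> in \<nu> \<beta>. \<not> recurs c \<omega> \<longrightarrow> indicator G \<omega> = (0::ennreal)"
          by (rule AE_I2) (auto simp: G_def)
      qed (use \<beta> g_le target_state G in \<open>auto simp: G_residual mult.commute\<close>)
      then show ?thesis
        using \<open>m \<noteq> 0\<close> by (auto split: if_splits)
    qed
    \<comment> \<open>Splitting off a first passage of \<open>c\<close> shortens \<open>w\<close> and, having no \<open>d\<close>, leaves a \<open>d\<close> before a \<open>c\<close> in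
      the rest.\<close>
    have no_d: False
      if "\<beta> \<in> X" "g \<beta> = m" "w \<in> lists \<Sigma>" "trace_of w \<in> traces_from \<beta>" "occurs_before d c w" for \<beta> w
      using that
    proof (induction "length w" arbitrary: \<beta> w rule: less_induct)
      case less
      have "0 < occurrences c (trace_of w)"
        using occurs_before_set[OF less.prems(5)] less.prems(3)
        by (auto simp: occurrences_trace_of count_list_0_iff simp flip: neq0_conv)
      then obtain v where v: "v \<in> first_passage c" "v \<preceq> trace_of w"
        using first_passage_exists less.prems(3) by blast
      then have v_carrier: "v \<in> carrier M" "0 < occurrences c v"
        by (auto simp: first_passage_def)
      obtain t where t: "t \<in> carrier M" "trace_of w = v \<diamondop> t"
        using v(2) by (auto elim: trace_leE)
      obtain v0 t0 where v0: "v0 \<in> lists \<Sigma>" "v = trace_of v0" and t0: "t0 \<in> lists \<Sigma>" "t = trace_of t0"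
        using traceE[OF v_carrier(1)] traceE[OF t(1)] by metis
      have vt: "v \<in> traces_from \<beta>" "t \<in> traces_from (target \<beta> v)"
        using mult_traces_from_iff[OF less.prems(1) v_carrier(1) t(1)] t(2) less.prems(4) by auto
      have step_v: "occurrences d v = 0" "g (target \<beta> v) = m"
        using step[OF less.prems(1,2) v(1) vt(1)] by auto
      have eq: "commutation_eq I w (v0 @ t0)"
      proof -
        have "trace_of w = trace_of (v0 @ t0)"
          using t(2) v0 t0 by (simp add: mult_trace)
        then show ?thesis
          using less.prems(3) v0(1) t0(1) by (simp add: trace_eq_iff)
      qed
      have "d \<notin> set v0" "v0 \<noteq> []"
        using step_v(1) v_carrier(2) v0 by (auto simp: occurrences_trace_of count_list_0_iff)
      moreover have "occurs_before d c (v0 @ t0)"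
        using commutation_eq_occurs_before[OF eq cd(3) indep_sym] less.prems(5) by simp
      ultimately have "occurs_before d c t0"
        using occurs_before_set[of d c v0] by (auto simp: occurs_before_append)
      moreover have "length t0 < length w"
        using commutation_eq_length[OF eq] \<open>v0 \<noteq> []\<close> by simp
      ultimately show False
        using less.hyps[of t0 "target \<beta> v"] target_state[OF less.prems(1) vt(1)] step_v(2) t0 vt(2) by simp
    qed
    have enabled: "\<exists>u\<in>lists \<Sigma>. trace_of (u @ [a]) \<in> traces_from \<beta>" if "\<beta> \<in> X" "a \<in> \<Sigma>" for \<beta> a
    proof -
      have "\<exists>u\<in>carrier M. act (Some \<beta>) (u \<diamondop> letter a) \<noteq> None"
        using irreducible that by (simp add: irreducible_system_def)
      then obtain u where u: "u \<in> carrier M" "act (Some \<beta>) (u \<diamondop> letter a) \<noteq> None" ..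
      obtain u0 where "u0 \<in> lists \<Sigma>" "u = trace_of u0"
        using traceE[OF u(1)] .
      then show ?thesis
        using u that by (intro bexI[of _ u0]) (auto simp: traces_from_def mult_trace)
    qed
    \<comment> \<open>Irreducibility enables a trace that reaches \<open>d\<close>, followed by one that reaches \<open>c\<close>.\<close>
    obtain u where u: "u \<in> lists \<Sigma>" "trace_of (u @ [d]) \<in> traces_from \<alpha>0"
      using enabled[OF \<alpha>0(1) cd(2)] by blast
    define \<beta> where "\<beta> = target \<alpha>0 (trace_of (u @ [d]))"
    have "\<beta> \<in> X"
      using u \<alpha>0 target_state by (simp add: \<beta>_def)
    then obtain u' where u': "u' \<in> lists \<Sigma>" "trace_of (u' @ [c]) \<in> traces_from \<beta>"
      using enabled cd(1) by blast
    have lists: "u @ [d] \<in> lists \<Sigma>" "u' @ [c] \<in> lists \<Sigma>"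
      using u u' cd by auto
    then have "trace_of (u @ [d]) \<diamondop> trace_of (u' @ [c]) \<in> traces_from \<alpha>0"
      using u u' \<alpha>0 by (subst mult_traces_from_iff) (auto simp: \<beta>_def)
    then have "trace_of ((u @ [d]) @ (u' @ [c])) \<in> traces_from \<alpha>0"
      using lists by (simp only: mult_trace)
    moreover have "occurs_before d c ((u @ [d]) @ (u' @ [c]))"
      by (auto simp: occurs_before_append)
    moreover have "(u @ [d]) @ (u' @ [c]) \<in> lists \<Sigma>"
      using lists by simp
    ultimately show False
      using no_d[OF \<alpha>0] by blast
  qed
qed

lemma AE_recurs:
  assumes "\<alpha> \<in> X"
  shows "AE \<omega> in \<nu> \<alpha>. \<forall>a\<in>\<Sigma>. recurs a \<omega>"
proof -
  define J where "J = {(c, d) \<in> \<Sigma> \<times> \<Sigma>. (c, d) \<notin> I}"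
  have "AE \<omega> in \<nu> \<alpha>. below x \<omega> \<longrightarrow> \<not> (recurs c (residual x \<omega>) \<and> avoids d (residual x \<omega>))"
    if x: "x \<in> carrier M" and cd: "c \<in> \<Sigma>" "d \<in> \<Sigma>" "(c, d) \<notin> I" for x c d
  proof (cases "x \<in> traces_from \<alpha>")
    case False
    then have "up x \<in> null_sets (\<nu> \<alpha>)"
      using assms x by (intro null_setsI up_null) (auto simp: sets_\<nu>)
    then show ?thesis
      using AE_not_in[of "up x" "\<nu> \<alpha>"] AE_space[of "\<nu> \<alpha>"] assms by (auto simp: up_def space_\<nu>)
  next
    case True
    let ?G = "{\<omega> \<in> boundary. recurs c \<omega> \<and> avoids d \<omega>}"
    have meas: "(\<lambda>\<omega>. indicator ?G (residual x \<omega>) * indicator (up x) \<omega> :: ennreal) \<in> borel_measurable (\<nu> \<alpha>)"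
    proof -
      have "(\<lambda>\<omega>. indicator ?G (residual x \<omega>) :: ennreal) \<in> borel_measurable (restrict_space (\<nu> \<alpha>) (up x))"
        using measurable_residual_\<nu>[OF assms x] by measurable
      then show ?thesis
        using assms by (subst (asm) borel_measurable_restrict_space_iff_ennreal) (auto simp: sets_\<nu> space_\<nu>)
    qed
    have "(\<integral>\<^sup>+\<omega>\<in>up x. indicator ?G (residual x \<omega>) \<partial>\<nu> \<alpha>) = 0"
      using True assms cd target_state[OF assms True]
      by (simp add: nn_integral_residual sets_\<nu> recurs_avoids_null)
    then have "AE \<omega> in \<nu> \<alpha>. indicator ?G (residual x \<omega>) * indicator (up x) \<omega> = (0::ennreal)"
      using meas by (subst (asm) nn_integral_0_iff_AE) auto
    with AE_space show ?thesis
      by eventually_elim (use assms x residual_boundary in \<open>auto simp: up_def space_\<nu> split: split_indicator_asm\<close>)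
  qed
  then have "AE \<omega> in \<nu> \<alpha>. \<forall>x\<in>carrier M. \<forall>(c, d)\<in>J. below x \<omega> \<longrightarrow>
      \<not> (recurs c (residual x \<omega>) \<and> avoids d (residual x \<omega>))"
    using finite_alphabet countable_carrier
    by (intro AE_ball_countable' countable_finite[of J])
       (auto simp: J_def intro: finite_subset[of _ "\<Sigma> \<times> \<Sigma>"])
  with AE_space show ?thesis
  proof eventually_elim
    case (elim \<omega>)
    show ?case
    proof (rule ballI, rule ccontr)
      fix a assume a: "a \<in> \<Sigma>" "\<not> recurs a \<omega>"
      have "\<omega> \<in> boundary" irreducible_monoid
        using elim(1) assms irreducible by (auto simp: space_\<nu> irreducible_system_def)
      then obtain x c d where "x \<in> carrier M" "below x \<omega>" "c \<in> \<Sigma>" "d \<in> \<Sigma>" "(c, d) \<notin> I"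
        "recurs c (residual x \<omega>)" "avoids d (residual x \<omega>)"
        using recurs_or_eventually_avoids a by metis
      then show False
        using elim(2) by (auto simp: J_def)
    qed
  qed
qed

section \<open>Shift-invariant families are constant\<close>

text \<open>A state of maximal mean passes maximality on to every enabled letter: the letter is a first
passage of itself. Boundedness keeps the maximum finite, so that it can be compared and cancelled.\<close>

lemma residual_invariant_constant:
  fixes F :: "'s \<Rightarrow> (nat \<Rightarrow> 'a set) \<Rightarrow> ennreal"
  assumes F: "\<And>\<alpha>. \<alpha> \<in> X \<Longrightarrow> F \<alpha> \<in> borel_measurable boundary_space"
    and bounded: "\<And>\<alpha> \<omega>. \<alpha> \<in> X \<Longrightarrow> F \<alpha> \<omega> \<le> K" "K < \<infinity>"
    and inv: "\<And>\<alpha>. \<alpha> \<in> X \<Longrightarrow>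
      AE \<omega> in \<nu> \<alpha>. \<forall>x\<in>traces_from \<alpha>. below x \<omega> \<longrightarrow> F \<alpha> \<omega> = F (target \<alpha> x) (residual x \<omega>)"
  shows "\<exists>m. \<forall>\<alpha>\<in>X. AE \<omega> in \<nu> \<alpha>. F \<alpha> \<omega> = m"
proof (cases "X = {}")
  case False
  define h where "h \<alpha> = (\<integral>\<^sup>+\<omega>. F \<alpha> \<omega> \<partial>\<nu> \<alpha>)" for \<alpha>
  define m where "m = Max (h ` X)"
  have h_le: "h \<beta> \<le> m" if "\<beta> \<in> X" for \<beta>
    using that finite_states by (simp add: m_def)
  have "m \<in> h ` X"
    unfolding m_def using finite_states False by (intro Max_in) auto
  then obtain \<alpha>0 where \<alpha>0: "\<alpha>0 \<in> X" "h \<alpha>0 = m" by auto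
  have "h \<alpha>0 \<le> (\<integral>\<^sup>+\<omega>. K \<partial>\<nu> \<alpha>0)"
    unfolding h_def using bounded \<alpha>0 by (intro nn_integral_mono) auto
  also have "\<dots> = K"
    using prob_space.emeasure_space_1[OF prob_space_\<nu>[OF \<alpha>0(1)]] by simp
  finally have "m < \<infinity>"
    using bounded(2) \<alpha>0 by simp
  have up_integral: "(\<integral>\<^sup>+\<omega>\<in>up x. F \<alpha> \<omega> \<partial>\<nu> \<alpha>) = emeasure (\<nu> \<alpha>) (up x) * h (target \<alpha> x)"
    if "\<alpha> \<in> X" "x \<in> traces_from \<alpha>" for \<alpha> x
  proof -
    have "(\<integral>\<^sup>+\<omega>\<in>up x. F \<alpha> \<omega> \<partial>\<nu> \<alpha>) = (\<integral>\<^sup>+\<omega>\<in>up x. F (target \<alpha> x) (residual x \<omega>) \<partial>\<nu> \<alpha>)"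
      using inv[OF that(1)] that(2)
      by (intro nn_integral_cong_AE) (auto simp: up_def split: split_indicator elim!: eventually_mono)
    then show ?thesis
      using that F target_state by (simp add: nn_integral_residual h_def)
  qed
  have letter_step: "h (target \<alpha> (letter a)) = m"
    if \<alpha>: "\<alpha> \<in> X" "h \<alpha> = m" and a: "a \<in> \<Sigma>" "letter a \<in> traces_from \<alpha>" for \<alpha> a
  proof (rule first_passage_max_principle[where k = "\<lambda>v. h (target \<alpha> v)" and c = a, OF \<alpha>(1)])
    show "AE \<omega> in \<nu> \<alpha>. \<not> recurs a \<omega> \<longrightarrow> F \<alpha> \<omega> = 0"
      using AE_recurs[OF \<alpha>(1)] by eventually_elim (use a in auto)
    show "(\<integral>\<^sup>+\<omega>. F \<alpha> \<omega> \<partial>\<nu> \<alpha>) = m"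
      using \<alpha> by (simp add: h_def)
  qed (use \<alpha> a F h_le target_state \<open>m < \<infinity>\<close> letter_first_passage in \<open>auto simp: up_integral mult.commute\<close>)
  have trace_step: "h (target \<alpha> x) = m"
    if "x \<in> carrier M" "\<alpha> \<in> X" "h \<alpha> = m" "x \<in> traces_from \<alpha>" for \<alpha> x
    using that
  proof (induction arbitrary: \<alpha> rule: trace_induct)
    case one
    then show ?case by (simp add: act_one)
  next
    case (letter a x)
    have *: "letter a \<in> traces_from \<alpha>" "x \<in> traces_from (target \<alpha> (letter a))"
      using letter mult_traces_from_iff[of \<alpha> "letter a" x] by auto
    then show ?case
      using letter letter_step target_state target_mult by simp
  qed
  have h_eq: "h \<beta> = m" if "\<beta> \<in> X" for \<beta>
  proof -
    have "traces_between \<alpha>0 \<beta> \<noteq> {}"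
      using irreducible that \<alpha>0(1) by (simp add: irreducible_system_def transitive_def)
    then obtain x where "x \<in> carrier M" "act (Some \<alpha>0) x = Some \<beta>"
      by (auto simp: traces_between_def)
    then show ?thesis
      using trace_step[of x \<alpha>0] \<alpha>0 by (simp add: traces_from_def)
  qed
  have "AE \<omega> in \<nu> \<alpha>. F \<alpha> \<omega> = m" if \<alpha>: "\<alpha> \<in> X" for \<alpha>
  proof -
    interpret prob_space "\<nu> \<alpha>"
      using \<alpha> by (rule prob_space_\<nu>)
    have F\<alpha> [measurable]: "F \<alpha> \<in> borel_measurable (\<nu> \<alpha>)"
      using F \<alpha> by (simp add: measurable_cong_sets[OF sets_\<nu> HOL.refl])
    have "density (\<nu> \<alpha>) (F \<alpha>) = density (\<nu> \<alpha>) (\<lambda>_. m)"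
    proof (rule measure_eqI_up)
      have up [measurable]: "up x \<in> sets (\<nu> \<alpha>)" for x
        using \<alpha> by (simp add: sets_\<nu>)
      show "emeasure (density (\<nu> \<alpha>) (F \<alpha>)) (up x) = emeasure (density (\<nu> \<alpha>) (\<lambda>_. m)) (up x)"
        if x: "x \<in> carrier M" for x
      proof (cases "x \<in> traces_from \<alpha>")
        case True
        then show ?thesis
          using \<alpha> h_eq target_state
          by (simp add: emeasure_density up_integral nn_integral_cmult_indicator mult.commute)
      next
        case False
        then show ?thesis
          using \<alpha> x by (simp add: emeasure_density nn_integral_up_outside)
      qed
      have "emeasure (density (\<nu> \<alpha>) (F \<alpha>)) boundary = h \<alpha>"
        using up[of \<epsilon>] \<alpha> unfolding h_def
        by (subst emeasure_density) (auto simp: space_\<nu> intro!: nn_integral_cong)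
      then show "emeasure (density (\<nu> \<alpha>) (F \<alpha>)) boundary \<noteq> \<infinity>"
        using h_eq[OF \<alpha>] \<open>m < \<infinity>\<close> by simp
    qed (use \<alpha> sets_\<nu> in auto)
    then show ?thesis
      by (simp add: density_unique_iff)
  qed
  then show ?thesis by blast
qed simp

end

theorem theorem5p2:
  fixes \<Sigma> :: "'a set" and I :: "('a \<times> 'a) set"
    and X :: "'s set" and act :: "'s option \<Rightarrow> 'a list set \<Rightarrow> 's option"
    and \<nu> :: "'s \<Rightarrow> (nat \<Rightarrow> 'a set) measure"
    and Z :: "'s \<Rightarrow> (nat \<Rightarrow> 'a set) \<Rightarrow> real"
  assumes "concurrent_system \<Sigma> I X act"
    and "concurrent_system.irreducible_system \<Sigma> I X act"
    and "concurrent_system.markov_measure \<Sigma> I X act \<nu>"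
    and "\<And>\<alpha>. \<alpha> \<in> X \<Longrightarrow>
           Z \<alpha> \<in> borel_measurable (restrict_space (trace_monoid.boundary_space \<Sigma> I)
                                   (concurrent_system.boundary_from \<Sigma> I act \<alpha>))"
    and "\<And>\<alpha>. \<alpha> \<in> X \<Longrightarrow>
           (\<forall>\<omega>\<in>concurrent_system.boundary_from \<Sigma> I act \<alpha>. 0 \<le> Z \<alpha> \<omega>) \<or>
           bounded (Z \<alpha> ` concurrent_system.boundary_from \<Sigma> I act \<alpha>)"
    and "concurrent_system.shift_invariant \<Sigma> I X act \<nu> Z"
  shows "\<exists>z. \<forall>\<alpha>\<in>X. AE \<omega> in \<nu> \<alpha>. \<omega> \<in> concurrent_system.boundary_from \<Sigma> I act \<alpha> \<longrightarrow> Z \<alpha> \<omega> = z"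
proof -
  interpret concurrent_system \<Sigma> I X act by fact
  interpret irreducible_markov_system \<Sigma> I X act \<nu>
    by unfold_locales (use assms in auto)
  have from_sets: "boundary_from \<alpha> \<in> sets boundary_space" for \<alpha>
  proof -
    have "boundary_from \<alpha> = boundary - (\<Union>x\<in>carrier M - traces_from \<alpha>. up x)"
      by (auto simp: boundary_from_def up_def)
    also have "\<dots> \<in> sets boundary_space"
      using countable_carrier sets.top[of boundary_space]
      by (intro sets.Diff sets.countable_UN') (auto intro: countable_subset)
    finally show ?thesis .
  qed
  \<comment> \<open>\<open>arctan\<close> makes the family bounded and loses no information; the shift by \<open>2\<close> makes it positive, so
    that it embeds into the extended non-negative reals.\<close>
  define F :: "'s \<Rightarrow> (nat \<Rightarrow> 'a set) \<Rightarrow> ennreal"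
    where "F \<alpha> \<omega> = ennreal (arctan (Z \<alpha> \<omega>) + 2) * indicator (boundary_from \<alpha>) \<omega>" for \<alpha> \<omega>
  have [simp]: "boundary_from \<alpha> \<inter> boundary = boundary_from \<alpha>" for \<alpha>
    by (auto simp: boundary_from_def)
  have arctan_bounds: "0 < arctan t + 2" "arctan t + 2 < 4" for t
    using arctan_lbound[of t] arctan_ubound[of t] pi_less_4 by linarith+
  have AE_from: "AE \<omega> in \<nu> \<alpha>. \<omega> \<in> boundary_from \<alpha>" if "\<alpha> \<in> X" for \<alpha>
    using assms(3) that from_sets[of \<alpha>]
    by (subst prob_space.prob_eq_1[symmetric]) (auto simp: markov_measure_def sets_\<nu> prob_space_\<nu>)
  have "\<exists>m. \<forall>\<alpha>\<in>X. AE \<omega> in \<nu> \<alpha>. F \<alpha> \<omega> = m"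
  proof (rule residual_invariant_constant[where K = 4])
    fix \<alpha> assume \<alpha>: "\<alpha> \<in> X"
    have [measurable]: "Z \<alpha> \<in> borel_measurable (restrict_space boundary_space (boundary_from \<alpha>))"
      using assms(4) \<alpha> .
    have "(\<lambda>\<omega>. ennreal (arctan (Z \<alpha> \<omega>) + 2)) \<in> borel_measurable (restrict_space boundary_space (boundary_from \<alpha>))"
      by measurable
    then show "F \<alpha> \<in> borel_measurable boundary_space"
      unfolding F_def using from_sets[of \<alpha>]
      by (subst (asm) borel_measurable_restrict_space_iff_ennreal) auto
    show "F \<alpha> \<omega> \<le> 4" for \<omega>
      using arctan_bounds(2)[of "Z \<alpha> \<omega>"] ennreal_leI[of "arctan (Z \<alpha> \<omega>) + 2" 4]
      by (auto simp: F_def split: split_indicator)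
    have "AE \<omega> in \<nu> \<alpha>. \<omega> \<in> boundary_from \<alpha> \<longrightarrow> (\<forall>x\<in>traces_from \<alpha>. below x \<omega> \<longrightarrow>
        Z \<alpha> \<omega> = Z (target \<alpha> x) (residual x \<omega>))"
      using assms(6) \<alpha> by (simp add: shift_invariant_def)
    with AE_from[OF \<alpha>]
    show "AE \<omega> in \<nu> \<alpha>. \<forall>x\<in>traces_from \<alpha>. below x \<omega> \<longrightarrow> F \<alpha> \<omega> = F (target \<alpha> x) (residual x \<omega>)"
    proof eventually_elim
      case (elim \<omega>)
      show ?case
      proof (intro ballI impI)
        fix x assume x: "x \<in> traces_from \<alpha>" "below x \<omega>"
        have \<omega>: "\<omega> \<in> boundary" "x \<in> carrier M"
          using elim(1) x by (auto simp: boundary_from_def traces_from_def)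
        have "residual x \<omega> \<in> boundary_from (target \<alpha> x)"
          unfolding boundary_from_def
        proof (intro CollectI conjI ballI impI)
          fix y assume y: "y \<in> carrier M" "below y (residual x \<omega>)"
          then have "below (x \<diamondop> y) \<omega>"
            using below_residual[OF \<omega>(2,1) x(2) y(1)] by simp
          then have "x \<diamondop> y \<in> traces_from \<alpha>"
            using elim(1) \<omega> y by (auto simp: boundary_from_def)
          then show "y \<in> traces_from (target \<alpha> x)"
            using mult_traces_from_iff[OF \<alpha> \<omega>(2) y(1)] by simp
        qed (rule residual_boundary[OF \<omega>(2,1) x(2)])
        then show "F \<alpha> \<omega> = F (target \<alpha> x) (residual x \<omega>)"
          using elim x by (simp add: F_def)
      qed
    qed
  qed simp
  then obtain m where m: "\<And>\<alpha>. \<alpha> \<in> X \<Longrightarrow> AE \<omega> in \<nu> \<alpha>. F \<alpha> \<omega> = m"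
    by blast
  show ?thesis
  proof (intro exI ballI)
    fix \<alpha> assume \<alpha>: "\<alpha> \<in> X"
    show "AE \<omega> in \<nu> \<alpha>. \<omega> \<in> boundary_from \<alpha> \<longrightarrow> Z \<alpha> \<omega> = tan (enn2real m - 2)"
      using m[OF \<alpha>]
    proof eventually_elim
      case (elim \<omega>)
      show ?case
      proof
        assume "\<omega> \<in> boundary_from \<alpha>"
        then have "enn2real m = arctan (Z \<alpha> \<omega>) + 2"
          using elim arctan_bounds(1)[of "Z \<alpha> \<omega>"] by (auto simp: F_def)
        then show "Z \<alpha> \<omega> = tan (enn2real m - 2)"
          by (simp add: tan_arctan)
      qed
    qed
  qed
qed

end
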